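(* Let $1<p<\infty$ and $q=\frac p{p-1}$. (1) If $A\in(\ell_p(\Delta^{(\tilde\alpha)}),c_0)$, then $L_A$ is compact if and only if $\lim_{r\to\infty}\sup_{n\ge r}\big(\sum_{k=0}^\infty|\hat a_{nk}|^q\big)^{1/q}=0$. (2) If $A\in(\ell_p(\Delta^{(\tilde\alpha)}),c)$, then $L_A$ is compact if and only if $\lim_{r\to\infty}\sup_{n\ge r}\big(\sum_{k=0}^\infty|\hat a_{nk}-\hat\alpha_k|^q\big)^{1/q}=0$, where $\hat\alpha_k=\lim_{n\to\infty}\hat a_{nk}$. (4) If $A\in(\ell_p(\Delta^{(\tilde\alpha)}),\ell_1)$, then $L_A$ is compact if and only if $\lim_{r\to\infty}\sup_{N\in\mathcal F_r}\big(\sum_{k=0}^\infty\big|\sum_{n\in N}\hat a_{nk}\big|^q\big)^{1/q}=0$. (5) If $A\in(\ell_1(\Delta^{(\tilde\alpha)}),c_0)$, then $L_A$ is compact if and only if $\lim_{r\to\infty}\sup_{n\ge r}\big(\sup_k|\hat a_{nk}|\big)=0$. (6) If $A\in(\ell_1(\Delta^{(\tilde\alpha)}),c)$, then $L_A$ is compact if and only if $\lim_{r\to\infty}\sup_{n\ge r}\big(\sup_k|\hat a_{nk}-\hat\alpha_k|\big)=0$, where $\hat\alpha_k=\lim_{n\to\infty}\hat a_{nk}$.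
   Context: $\omega$ is the set of all complex sequences $x=(x_k)_{k\ge0}$; $c_0$ and $c$ (null and convergent sequences) carry the sup norm, and $\ell_p$ ($1\le p<\infty$) its usual norm. Fix a fraction $\tilde\alpha$ (a real non-integer number). For $x\in\omega$ put $$(\Delta^{(\tilde\alpha)}x)_k=\sum_{i=0}^{k}(-1)^i\frac{\Gamma(\tilde\alpha+1)}{i!\,\Gamma(\tilde\alpha-i+1)}x_{k-i}$$ (terms with negative index are zero). For $1\le p<\infty$, $\ell_p(\Delta^{(\tilde\alpha)})=\{x\in\omega:\Delta^{(\tilde\alpha)}x\in\ell_p\}$, a Banach space with norm $\|x\|=\|\Delta^{(\tilde\alpha)}x\|_{\ell_p}$. For an infinite complex matrix $A=(a_{nk})_{n,k\ge0}$ and $X,Y\subset\omega$, $A\in(X,Y)$ means that for every $x\in X$ the series $A_nx=\sum_{k=0}^\infty a_{nk}x_k$ converges for all $n$ and $Ax=(A_nx)_{n\ge0}\in Y$. $L_A:X\to Y$ denotes the (bounded) operator $L_A(x)=Ax$. The matrix $\hat A=(\hat a_{nk})$ associated with $A$ is $$\hat a_{nk}=\sum_{j=k}^\infty(-1)^{j-k}\frac{\Gamma(-\tilde\alpha+1)}{(j-k)!\,\Gamma(-\tilde\alpha-j+k+1)}a_{nj}$$ (these series converge whenever $A$ maps $\ell_p(\Delta^{(\tilde\alpha)})$ into some subset of $\omega$). $\mathcal F_r$ is the collection of all nonempty finite subsets $N$ of $\{0,1,2,\dots\}$ such that $n>r$ for all $n\in N$. *)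

theory Defs
  imports "HOL-Analysis.Analysis"
begin

type_synonym cseq = "nat \<Rightarrow> complex"

definition c_space :: "cseq set" where
  "c_space = {x. convergent x}"

definition c0_space :: "cseq set" where
  "c0_space = {x. x \<longlonglongrightarrow> 0}"

definition sup_norm :: "cseq \<Rightarrow> real" where
  "sup_norm x = (SUP k. cmod (x k))"

definition lp_space :: "real \<Rightarrow> cseq set" where
  "lp_space p = {x. summable (\<lambda>k. cmod (x k) powr p)}"

definition lp_norm :: "real \<Rightarrow> cseq \<Rightarrow> real" where
  "lp_norm p x = (\<Sum>k. cmod (x k) powr p) powr (1 / p)"

(* The same norms as extended values on all sequences, so that a divergent sum or an
   unbounded supremum is infinite rather than an arbitrary real. *)

definition elp_norm :: "real \<Rightarrow> cseq \<Rightarrow> ennreal" where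
  "elp_norm p x = (if x \<in> lp_space p then ennreal (lp_norm p x) else \<infinity>)"

definition esup_norm :: "cseq \<Rightarrow> ennreal" where
  "esup_norm x = (SUP k. ennreal (cmod (x k)))"

definition frac_coeff :: "real \<Rightarrow> nat \<Rightarrow> real" where
  "frac_coeff \<alpha> i = (-1) ^ i * Gamma (\<alpha> + 1) / (fact i * Gamma (\<alpha> - real i + 1))"

definition frac_diff :: "real \<Rightarrow> cseq \<Rightarrow> cseq" where
  "frac_diff \<alpha> x = (\<lambda>k. \<Sum>i\<le>k. complex_of_real (frac_coeff \<alpha> i) * x (k - i))"

definition lp_diff_space :: "real \<Rightarrow> real \<Rightarrow> cseq set" where
  "lp_diff_space \<alpha> p = {x. frac_diff \<alpha> x \<in> lp_space p}"

definition lp_diff_norm :: "real \<Rightarrow> real \<Rightarrow> cseq \<Rightarrow> real" where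
  "lp_diff_norm \<alpha> p x = lp_norm p (frac_diff \<alpha> x)"

type_synonym cmatrix = "nat \<Rightarrow> nat \<Rightarrow> complex"

definition mat_apply :: "cmatrix \<Rightarrow> cseq \<Rightarrow> cseq" where
  "mat_apply A x = (\<lambda>n. \<Sum>k. A n k * x k)"

definition matrix_class :: "cseq set \<Rightarrow> cseq set \<Rightarrow> cmatrix set" where
  "matrix_class X Y =
    {A. \<forall>x\<in>X. (\<forall>n. summable (\<lambda>k. A n k * x k)) \<and> mat_apply A x \<in> Y}"

(* The series over j \<ge> k, with j = k + i. *)
definition hat_matrix :: "real \<Rightarrow> cmatrix \<Rightarrow> cmatrix" where
  "hat_matrix \<alpha> A = (\<lambda>n k. \<Sum>i. complex_of_real (frac_coeff (- \<alpha>) i) * A n (k + i))"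

definition hat_limit :: "real \<Rightarrow> cmatrix \<Rightarrow> cseq" where
  "hat_limit \<alpha> A = (\<lambda>k. lim (\<lambda>n. hat_matrix \<alpha> A n k))"

definition finite_sets_above :: "nat \<Rightarrow> nat set set" where
  "finite_sets_above r = {N. finite N \<and> N \<noteq> {} \<and> (\<forall>n\<in>N. n > r)}"

(* The spaces carry different norms on subsets of one type, so each norm is passed
   along with its carrier. *)

definition linear_between :: "cseq set \<Rightarrow> cseq set \<Rightarrow> (cseq \<Rightarrow> cseq) \<Rightarrow> bool" where
  "linear_between X Y L \<longleftrightarrow>
    (\<forall>x\<in>X. L x \<in> Y) \<and>
    (\<forall>x\<in>X. \<forall>y\<in>X. L (\<lambda>k. x k + y k) = (\<lambda>k. L x k + L y k)) \<and>
    (\<forall>a. \<forall>x\<in>X. L (\<lambda>k. a * x k) = (\<lambda>k. a * L x k))"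

definition compact_operator ::
    "cseq set \<Rightarrow> (cseq \<Rightarrow> real) \<Rightarrow> cseq set \<Rightarrow> (cseq \<Rightarrow> real) \<Rightarrow> (cseq \<Rightarrow> cseq) \<Rightarrow> bool" where
  "compact_operator X normX Y normY L \<longleftrightarrow>
    linear_between X Y L \<and>
    (\<forall>u :: nat \<Rightarrow> cseq. (\<forall>m. u m \<in> X) \<and> (\<exists>B. \<forall>m. normX (u m) \<le> B) \<longrightarrow>
      (\<exists>y\<in>Y. \<exists>s :: nat \<Rightarrow> nat. strict_mono s \<and>
        (\<lambda>m. normY (\<lambda>k. L (u (s m)) k - y k)) \<longlonglongrightarrow> 0))"

end

theory Submission
  imports Defs "HOL-Library.Diagonal_Subsequence"
begin

text \<open>The substitution \<open>y = frac_diff \<alpha> x\<close> is a bijection with inverse \<open>frac_diff (-\<alpha>)\<close> (Vandermonde),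
  so it identifies \<open>lp_diff_space \<alpha> p\<close> isometrically with \<open>\<ell>\<^sub>p\<close>. By uniform boundedness each
  row of \<open>A\<close> becomes a bounded functional on \<open>\<ell>\<^sub>p\<close>, represented by the corresponding row of the hat matrix.
  Compactness then means that the image of the unit ball is uniformly small at infinity: in \<open>c\<close> after
  subtracting limits, and in \<open>\<ell>\<^sub>1\<close> in the sense of tails, which up to a factor of 4 are
  controlled by the moduli of finite subset sums. By duality the worst case over the unit ball is the
  \<open>\<ell>\<^sub>q\<close> or sup norm of the rows. If uniform smallness holds, a diagonal subsequence converges;
  if it fails, near-optimal finitely supported vectors have images without convergent subsequence.\<close>

section \<open>Sequences and fractional differences\<close>

text \<open>Row norms are handled through one predicate, \<open>dual_bounded p b M\<close>, which
  tests the functional with coefficients \<open>b\<close> on finite sections only. It makes sense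
  before any series is known to converge, survives entrywise limits of \<open>b\<close>, and its
  failure yields a finitely supported vector. On such vectors the matrix acts by finite sums, so
  limits over the rows pass inside at once. The exponent q enters only through the lemma that
  recognises the predicate as a bound on the l_q norm. The obstacle is that the change of variable
  rearranges a double series for which no absolute convergence is assumed. Only partial sums are
  rearranged, where everything is finite, and uniform boundedness controls the truncation error. For
  the target c, subtracting limits brings in a further functional, the entrywise limit of the rows.
  Its values on a bounded sequence have to converge along the extracted subsequence as well.\<close>

lemma ennreal_SUP_tendsto_0_iff:
  fixes S :: "nat \<Rightarrow> 'a set" and g :: "'a \<Rightarrow> ennreal"
  assumes "antimono S"
  shows "(\<lambda>r. SUP i\<in>S r. g i) \<longlonglongrightarrow> 0 \<longleftrightarrow> (\<forall>\<epsilon>>0. \<exists>r. \<forall>i\<in>S r. g i \<le> ennreal \<epsilon>)"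
proof (intro iffI allI impI)
  fix \<epsilon> :: real assume lim: "(\<lambda>r. SUP i\<in>S r. g i) \<longlonglongrightarrow> 0" and "\<epsilon> > 0"
  then have "\<forall>\<^sub>F r in sequentially. (SUP i\<in>S r. g i) < ennreal \<epsilon>"
    by (intro order_tendstoD(2)[OF lim]) auto
  then obtain r where r: "(SUP i\<in>S r. g i) < ennreal \<epsilon>"
    by (auto simp: eventually_sequentially)
  have "g i \<le> ennreal \<epsilon>" if "i \<in> S r" for i
    using SUP_upper[OF that, of g] r by (meson le_less_trans less_imp_le)
  then show "\<exists>r. \<forall>i\<in>S r. g i \<le> ennreal \<epsilon>" by blast
next
  assume small: "\<forall>\<epsilon>>0. \<exists>r. \<forall>i\<in>S r. g i \<le> ennreal \<epsilon>"
  show "(\<lambda>r. SUP i\<in>S r. g i) \<longlonglongrightarrow> 0"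
  proof (rule order_tendstoI)
    fix a :: ennreal assume "0 < a"
    \<comment> \<open>The bound \<open>a\<close> may be infinite; an intermediate \<open>z\<close>
      is finite and so comes from a real number.\<close>
    then obtain z where z: "0 < z" "z < a" using dense by blast
    have "z < top" using z(2) by (rule less_le_trans) simp
    then obtain \<epsilon> where \<epsilon>: "z = ennreal \<epsilon>" "\<epsilon> \<ge> 0"
      unfolding less_top_ennreal by blast
    with z have "\<epsilon> > 0" by (cases "\<epsilon> = 0") auto
    with small obtain r where r: "\<forall>i\<in>S r. g i \<le> ennreal \<epsilon>" by blast
    have "(SUP i\<in>S r'. g i) < a" if "r' \<ge> r" for r'
    proof -
      have "(SUP i\<in>S r'. g i) \<le> ennreal \<epsilon>"
        using antimonoD[OF assms that] r by (intro SUP_least) auto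
      then show ?thesis using z \<epsilon> by simp
    qed
    then show "\<forall>\<^sub>F r in sequentially. (SUP i\<in>S r. g i) < a"
      by (auto simp: eventually_sequentially)
  qed auto
qed

lemma pointwise_convergent_subsequence:
  fixes f :: "nat \<Rightarrow> nat \<Rightarrow> 'a::heine_borel"
  assumes "\<And>n. bounded (range (\<lambda>m. f m n))"
  obtains s :: "nat \<Rightarrow> nat" and y where "strict_mono s" "\<And>n. (\<lambda>m. f (s m) n) \<longlonglongrightarrow> y n"
proof -
  interpret subseqs "\<lambda>n s. convergent (\<lambda>m. f (s m) n)"
  proof
    fix n and s :: "nat \<Rightarrow> nat"
    have "bounded (range (\<lambda>m. f (s m) n))"
      by (rule bounded_subset[OF assms[of n]]) auto
    then obtain l r where "strict_mono (r::nat \<Rightarrow> nat)" "((\<lambda>m. f (s m) n) \<circ> r) \<longlonglongrightarrow> l"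
      using bounded_imp_convergent_subsequence by blast
    then show "\<exists>r'. strict_mono r' \<and> convergent (\<lambda>m. f ((s \<circ> r') m) n)"
      by (auto simp: convergent_def o_def)
  qed
  have "convergent (\<lambda>m. f (diagseq m) n)" for n
  proof -
    \<comment> \<open>Only the part of the diagonal beyond \<open>n\<close> is known to be a
      subsequence of the n-th extraction; the initial segment is irrelevant to convergence.\<close>
    have "convergent (\<lambda>m. f ((diagseq \<circ> (+) (Suc n)) m) n)"
    proof (rule diagseq_holds)
      fix r s :: "nat \<Rightarrow> nat" and n
      assume "strict_mono r" "convergent (\<lambda>m. f (s m) n)"
      then show "convergent (\<lambda>m. f ((s \<circ> r) m) n)"
        using convergent_subseq_convergent[of "\<lambda>m. f (s m) n" r] by (simp add: o_def)
    qed
    then show ?thesis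
      using convergent_ignore_initial_segment[of "\<lambda>m. f (diagseq m) n" "Suc n"]
      by (simp add: o_def add.commute)
  qed
  then have "(\<lambda>m. f (diagseq m) n) \<longlonglongrightarrow> lim (\<lambda>m. f (diagseq m) n)" for n
    by (simp add: convergent_LIMSEQ_iff)
  with subseq_diagseq show ?thesis by (rule that)
qed

text \<open>Splitting into real and imaginary parts, and each of these by sign, leaves four subset
  sums of size at most \<open>e\<close>. The empty set is excluded to match
  \<open>finite_sets_above\<close>; \<open>0 \<le> e\<close> accounts for it.\<close>

lemma sum_cmod_le_subset_sums:
  fixes z :: "'a \<Rightarrow> complex"
  assumes "finite F" and "\<And>N. N \<subseteq> F \<Longrightarrow> N \<noteq> {} \<Longrightarrow> cmod (\<Sum>n\<in>N. z n) \<le> e" and "0 \<le> e"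
  shows "(\<Sum>n\<in>F. cmod (z n)) \<le> 4 * e"
proof -
  have sub: "cmod (\<Sum>n\<in>N. z n) \<le> e" if "N \<subseteq> F" for N
    using assms that by (cases "N = {}") auto
  have real: "(\<Sum>n\<in>F. \<bar>g n\<bar>) \<le> 2 * e"
    if "\<And>N. N \<subseteq> F \<Longrightarrow> \<bar>\<Sum>n\<in>N. g n\<bar> \<le> e" for g :: "'a \<Rightarrow> real"
  proof -
    let ?P = "{n\<in>F. g n \<ge> 0}"
    have "(\<Sum>n\<in>F. \<bar>g n\<bar>) = (\<Sum>n\<in>?P. \<bar>g n\<bar>) + (\<Sum>n\<in>F - ?P. \<bar>g n\<bar>)"
      using sum.subset_diff[of ?P F "\<lambda>n. \<bar>g n\<bar>"] assms(1) by auto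
    also have "\<dots> = (\<Sum>n\<in>?P. g n) - (\<Sum>n\<in>F - ?P. g n)"
      unfolding diff_conv_add_uminus sum_negf[symmetric]
      by (intro arg_cong2[where f = "(+)"] sum.cong) auto
    also have "\<dots> \<le> 2 * e"
      using that[of ?P] that[of "F - ?P"] by fastforce
    finally show ?thesis .
  qed
  have "(\<Sum>n\<in>F. \<bar>Re (z n)\<bar>) \<le> 2 * e"
    by (rule real) (metis Re_sum abs_Re_le_cmod order_trans sub)
  moreover have "(\<Sum>n\<in>F. \<bar>Im (z n)\<bar>) \<le> 2 * e"
    by (rule real) (metis Im_sum abs_Im_le_cmod order_trans sub)
  moreover have "(\<Sum>n\<in>F. cmod (z n)) \<le> (\<Sum>n\<in>F. \<bar>Re (z n)\<bar> + \<bar>Im (z n)\<bar>)"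
    by (intro sum_mono cmod_le)
  ultimately show ?thesis by (simp add: sum.distrib)
qed

text \<open>A non-integer \<alpha> keeps \<alpha> + 1 away from the poles of \<open>Gamma\<close>,
  so the Gamma quotient is a generalized binomial coefficient. The numbers are thus the coefficients
  of (1 - t)^\<alpha>.\<close>

lemma frac_coeff_eq_gbinomial:
  assumes "\<alpha> \<notin> \<int>"
  shows "frac_coeff \<alpha> i = (-1) ^ i * (\<alpha> gchoose i)"
proof -
  have "\<alpha> + 1 \<notin> \<int>\<^sub>\<le>\<^sub>0"
    using assms by (metis Ints_1 Ints_diff add_diff_cancel_right' nonpos_Ints_subset_Ints subsetD)
  then show ?thesis
    by (simp add: frac_coeff_def gbinomial_Gamma)
qed

text \<open>This compares coefficients in (1 - t)^\<alpha> (1 - t)^(-\<alpha>) = 1: the signs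
  combine to (-1)^n, and the binomials sum to \<open>0 gchoose n\<close>.\<close>

lemma frac_coeff_convolution:
  assumes "\<alpha> \<notin> \<int>"
  shows "(\<Sum>i=0..n. frac_coeff \<alpha> i * frac_coeff (-\<alpha>) (n - i)) = (if n = 0 then 1 else 0)"
proof -
  have "(\<Sum>i=0..n. frac_coeff \<alpha> i * frac_coeff (-\<alpha>) (n - i)) =
        (\<Sum>i=0..n. (-1) ^ n * ((\<alpha> gchoose i) * (-\<alpha> gchoose (n - i))))"
    using assms by (intro sum.cong) (auto simp: frac_coeff_eq_gbinomial power_add[symmetric])
  also have "\<dots> = (-1) ^ n * ((0::real) gchoose n)"
    using gbinomial_Vandermonde[of \<alpha> "-\<alpha>" n] by (simp add: sum_distrib_left[symmetric])
  finally show ?thesis by (cases n) auto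
qed

text \<open>As a product of formal power series, the difference operator can be inverted by
  associativity alone, without rearranging double sums.\<close>

lemma frac_diff_eq_fps:
  "frac_diff \<alpha> x = fps_nth (Abs_fps (\<lambda>i. complex_of_real (frac_coeff \<alpha> i)) * Abs_fps x)"
  by (simp add: frac_diff_def fps_mult_nth fun_eq_iff atLeast0AtMost)

lemma frac_diff_inverse:
  assumes "\<alpha> \<notin> \<int>"
  shows "frac_diff \<alpha> (frac_diff (-\<alpha>) x) = x"
proof -
  have "Abs_fps (\<lambda>i. complex_of_real (frac_coeff \<alpha> i)) *
        Abs_fps (\<lambda>i. complex_of_real (frac_coeff (-\<alpha>) i)) = 1"
  proof (rule fps_ext)
    fix n
    show "fps_nth (Abs_fps (\<lambda>i. complex_of_real (frac_coeff \<alpha> i)) *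
        Abs_fps (\<lambda>i. complex_of_real (frac_coeff (-\<alpha>) i))) n = fps_nth 1 n"
      using arg_cong[OF frac_coeff_convolution[OF assms, of n], of complex_of_real]
      by (simp add: fps_mult_nth)
  qed
  then show ?thesis
    by (simp add: frac_diff_eq_fps fps_nth_inverse fun_eq_iff flip: mult.assoc)
qed

section \<open>The spaces \<open>\<ell>\<^sub>p\<close> and their duals\<close>

lemma lp_norm_nonneg: "0 \<le> lp_norm p x"
  by (simp add: lp_norm_def)

lemma lp_norm_partial_sum_le:
  assumes "0 < p" "x \<in> lp_space p"
  shows "(\<Sum>k<K. cmod (x k) powr p) powr (1 / p) \<le> lp_norm p x"
  using assms unfolding lp_norm_def lp_space_def
  by (intro powr_mono2 sum_nonneg sum_le_suminf) auto

lemma lp_space_normI: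
  assumes "0 < p" "0 \<le> M" and bd: "\<And>K. (\<Sum>k<K. cmod (x k) powr p) \<le> M powr p"
  shows "x \<in> lp_space p" and "lp_norm p x \<le> M"
proof -
  have sm: "summable (\<lambda>k. cmod (x k) powr p)"
    using bd by (intro summableI_nonneg_bounded) auto
  then show "x \<in> lp_space p" by (simp add: lp_space_def)
  have "(\<Sum>k. cmod (x k) powr p) \<le> M powr p"
    using bd sm by (intro suminf_le_const)
  then have "lp_norm p x \<le> (M powr p) powr (1 / p)"
    unfolding lp_norm_def using assms(1) sm by (intro powr_mono2 suminf_nonneg) auto
  then show "lp_norm p x \<le> M" using assms by (simp add: powr_powr)
qed

lemma lp_space_finite_support:
  assumes "\<And>k. k \<ge> K \<Longrightarrow> x k = 0"
  shows "x \<in> lp_space p" and "lp_norm p x = (\<Sum>k<K. cmod (x k) powr p) powr (1 / p)"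
proof -
  have "(\<lambda>k. cmod (x k) powr p) sums (\<Sum>k<K. cmod (x k) powr p)"
    using assms by (intro sums_finite) auto
  then show "x \<in> lp_space p" "lp_norm p x = (\<Sum>k<K. cmod (x k) powr p) powr (1 / p)"
    by (auto simp: lp_space_def lp_norm_def sums_iff)
qed

lemma cmod_le_lp_norm:
  assumes "0 < p" "x \<in> lp_space p"
  shows "cmod (x k) \<le> lp_norm p x"
proof -
  have "(cmod (x k) powr p) powr (1 / p) \<le> lp_norm p x"
    unfolding lp_norm_def using assms
    by (intro powr_mono2) (auto simp: lp_space_def intro: sum_le_suminf[of _ "{k}", simplified])
  then show ?thesis using assms by (simp add: powr_powr)
qed

lemma lp_norm_cmult:
  assumes "0 < p" "x \<in> lp_space p"
  shows "(\<lambda>k. a * x k) \<in> lp_space p" and "lp_norm p (\<lambda>k. a * x k) = cmod a * lp_norm p x"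
proof -
  have sm: "summable (\<lambda>k. cmod (x k) powr p)" using assms by (simp add: lp_space_def)
  have eq: "(\<lambda>k. cmod (a * x k) powr p) = (\<lambda>k. cmod a powr p * cmod (x k) powr p)"
    by (simp add: norm_mult powr_mult)
  show "(\<lambda>k. a * x k) \<in> lp_space p"
    using sm by (simp add: lp_space_def eq summable_mult)
  show "lp_norm p (\<lambda>k. a * x k) = cmod a * lp_norm p x"
    using sm assms(1) suminf_nonneg[OF sm]
    by (simp add: lp_norm_def eq suminf_mult powr_mult powr_powr)
qed

text \<open>Only membership is at stake, so |x + y| <= 2 max(|x|, |y|) can stand in for Minkowski's
  inequality.\<close>

lemma lp_space_add:
  assumes "0 < p" "x \<in> lp_space p" "y \<in> lp_space p"
  shows "(\<lambda>k. x k + y k) \<in> lp_space p"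
proof -
  have bd: "cmod (x k + y k) powr p \<le> 2 powr p * (cmod (x k) powr p + cmod (y k) powr p)" for k
  proof -
    have "cmod (x k + y k) \<le> 2 * max (cmod (x k)) (cmod (y k))"
      using norm_triangle_ineq[of "x k" "y k"] by linarith
    then have "cmod (x k + y k) powr p \<le> (2 * max (cmod (x k)) (cmod (y k))) powr p"
      using assms(1) by (intro powr_mono2) auto
    also have "\<dots> = 2 powr p * max (cmod (x k)) (cmod (y k)) powr p"
      by (simp add: powr_mult)
    also have "\<dots> \<le> 2 powr p * (cmod (x k) powr p + cmod (y k) powr p)"
      by (intro mult_left_mono) (auto simp: max_def)
    finally show ?thesis .
  qed
  have "summable (\<lambda>k. 2 powr p * (cmod (x k) powr p + cmod (y k) powr p))"
    using assms by (intro summable_mult summable_add) (auto simp: lp_space_def)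
  then have "summable (\<lambda>k. cmod (x k + y k) powr p)"
    by (rule summable_comparison_test'[where N = 0]) (use bd in simp)
  then show ?thesis by (simp add: lp_space_def)
qed

lemma lp_space_diff:
  assumes "0 < p" "x \<in> lp_space p" "y \<in> lp_space p"
  shows "(\<lambda>k. x k - y k) \<in> lp_space p"
  using lp_space_add[OF assms(1,2) lp_norm_cmult(1)[OF assms(1,3), of "-1"]] by simp

text \<open>When one point is 0, convexity reduces to (u w)^p <= u w^p for 0 < u < 1, which holds
  because u^p <= u.\<close>

lemma powr_convex_nonneg:
  fixes p :: real
  assumes "1 \<le> p"
  shows "convex_on {0..} (\<lambda>x. x powr p)"
proof (intro convex_onI)
  fix t x y :: real
  assume t: "0 < t" "t < 1" and xy: "x \<in> {0..}" "y \<in> {0..}"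
  have scale: "(u * w) powr p \<le> u * w powr p" if "0 < u" "u < 1" for u w :: real
  proof -
    have "u powr p \<le> u powr 1" using that assms by (intro powr_mono') auto
    then show ?thesis using that by (simp add: powr_mult mult_right_mono)
  qed
  consider "x = 0" | "y = 0" | "0 < x" "0 < y" using xy by force
  then show "((1 - t) *\<^sub>R x + t *\<^sub>R y) powr p \<le> (1 - t) * x powr p + t * y powr p"
  proof cases
    case 1 then show ?thesis using scale[of t y] t by simp
  next
    case 2 then show ?thesis using scale[of "1 - t" x] t by simp
  next
    case 3 then show ?thesis
      using convex_onD[OF powr_convex[OF assms], of t x y] t by simp
  qed
qed (simp add: convex_real_interval)

text \<open>Minkowski's inequality for combinations of unit ball vectors: Jensen's inequality with
  weights |a_j| / \<sigma> in each coordinate, then summation over \<open>K\<close>.\<close>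

lemma sum_powr_weighted_sum_le:
  fixes z :: "'j \<Rightarrow> 'k \<Rightarrow> complex"
  assumes "1 \<le> p" "finite J" and z: "\<And>j. j \<in> J \<Longrightarrow> (\<Sum>k\<in>K. cmod (z j k) powr p) \<le> 1"
  shows "(\<Sum>k\<in>K. cmod (\<Sum>j\<in>J. a j * z j k) powr p) \<le> (\<Sum>j\<in>J. cmod (a j)) powr p"
proof (cases "(\<Sum>j\<in>J. cmod (a j)) = 0")
  case True
  then have "a j = 0" if "j \<in> J" for j
    using that assms(2) by (simp add: sum_nonneg_eq_0_iff)
  then show ?thesis by simp
next
  case False
  define \<sigma> where "\<sigma> = (\<Sum>j\<in>J. cmod (a j))"
  define u where "u j = cmod (a j) / \<sigma>" for j
  have "\<sigma> > 0" using False by (simp add: \<sigma>_def less_le sum_nonneg)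
  then have u: "(\<Sum>j\<in>J. u j) = 1" "\<And>j. u j \<ge> 0"
    by (simp_all add: u_def \<sigma>_def sum_divide_distrib[symmetric])
  have "J \<noteq> {}" using False by auto
  have "cmod (\<Sum>j\<in>J. a j * z j k) powr p \<le> \<sigma> powr p * (\<Sum>j\<in>J. u j * cmod (z j k) powr p)" for k
  proof -
    have "cmod (\<Sum>j\<in>J. a j * z j k) \<le> (\<Sum>j\<in>J. cmod (a j * z j k))" by (rule norm_sum)
    also have "\<dots> = \<sigma> * (\<Sum>j\<in>J. u j * cmod (z j k))"
      using \<open>\<sigma> > 0\<close> by (simp add: u_def sum_distrib_left norm_mult)
    finally have "cmod (\<Sum>j\<in>J. a j * z j k) powr p \<le> (\<sigma> * (\<Sum>j\<in>J. u j * cmod (z j k))) powr p"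
      using assms(1) by (intro powr_mono2) auto
    also have "\<dots> = \<sigma> powr p * (\<Sum>j\<in>J. u j *\<^sub>R cmod (z j k)) powr p"
      by (simp add: powr_mult)
    also have "\<dots> \<le> \<sigma> powr p * (\<Sum>j\<in>J. u j * cmod (z j k) powr p)"
      using convex_on_sum[OF assms(2) \<open>J \<noteq> {}\<close> powr_convex_nonneg[OF assms(1)] u(1,2), of "\<lambda>j. cmod (z j k)"]
      by (intro mult_left_mono) auto
    finally show ?thesis .
  qed
  then have "(\<Sum>k\<in>K. cmod (\<Sum>j\<in>J. a j * z j k) powr p)
      \<le> (\<Sum>k\<in>K. \<sigma> powr p * (\<Sum>j\<in>J. u j * cmod (z j k) powr p))"
    by (rule sum_mono)
  also have "\<dots> = \<sigma> powr p * (\<Sum>j\<in>J. u j * (\<Sum>k\<in>K. cmod (z j k) powr p))"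
    unfolding sum_distrib_left by (rule sum.swap)
  also have "\<dots> \<le> \<sigma> powr p * (\<Sum>j\<in>J. u j * 1)"
    using z u(2) by (intro mult_left_mono sum_mono) auto
  finally show ?thesis using u(1) by (simp add: \<sigma>_def)
qed

text \<open>The form in which completeness of l_p is used. The inequality for finitely many vectors
  is carried over with \<open>K\<close> fixed while the number of terms grows.\<close>

lemma lp_norm_suminf_le:
  assumes "1 \<le> p" and z: "\<And>j. z j \<in> lp_space p" "\<And>j. lp_norm p (z j) \<le> 1"
    and a: "summable (\<lambda>j. cmod (a j))"
  shows "summable (\<lambda>j. a j * z j k)"
    and "(\<lambda>k. \<Sum>j. a j * z j k) \<in> lp_space p"
    and "lp_norm p (\<lambda>k. \<Sum>j. a j * z j k) \<le> (\<Sum>j. cmod (a j))"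
proof -
  have p: "p > 0" using assms by simp
  have sm: "summable (\<lambda>j. a j * z j k)" for k
  proof (rule summable_comparison_test'[OF a])
    fix j
    show "cmod (a j * z j k) \<le> cmod (a j)"
      using cmod_le_lp_norm[OF p z(1)[of j], of k] z(2)[of j]
      by (simp add: norm_mult mult_left_le)
  qed
  then show "summable (\<lambda>j. a j * z j k)" .
  define \<tau> where "\<tau> = (\<Sum>j. cmod (a j))"
  have \<tau>: "\<tau> \<ge> 0" using a by (simp add: \<tau>_def suminf_nonneg)
  have z1: "(\<Sum>k<K. cmod (z j k) powr p) \<le> 1" for j K
  proof -
    have "((\<Sum>k<K. cmod (z j k) powr p) powr (1 / p)) powr p \<le> 1 powr p"
      using lp_norm_partial_sum_le[OF p z(1)[of j], of K] z(2)[of j] p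
      by (intro powr_mono2) auto
    then show ?thesis using p by (simp add: powr_powr sum_nonneg)
  qed
  have bd: "(\<Sum>k<K. cmod (\<Sum>j. a j * z j k) powr p) \<le> \<tau> powr p" for K
  proof (rule LIMSEQ_le_const2)
    show "(\<lambda>L. \<Sum>k<K. cmod (\<Sum>j<L. a j * z j k) powr p) \<longlonglongrightarrow> (\<Sum>k<K. cmod (\<Sum>j. a j * z j k) powr p)"
      using p sm by (intro tendsto_sum tendsto_powr' tendsto_norm summable_LIMSEQ) auto
    have "(\<Sum>k<K. cmod (\<Sum>j<L. a j * z j k) powr p) \<le> \<tau> powr p" for L
    proof -
      have "(\<Sum>k<K. cmod (\<Sum>j<L. a j * z j k) powr p) \<le> (\<Sum>j<L. cmod (a j)) powr p"
        using z1 by (intro sum_powr_weighted_sum_le assms(1)) auto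
      also have "\<dots> \<le> \<tau> powr p"
        unfolding \<tau>_def using a p by (intro powr_mono2 sum_le_suminf sum_nonneg) auto
      finally show ?thesis .
    qed
    then show "\<exists>N. \<forall>L\<ge>N. (\<Sum>k<K. cmod (\<Sum>j<L. a j * z j k) powr p) \<le> \<tau> powr p" by blast
  qed
  show "(\<lambda>k. \<Sum>j. a j * z j k) \<in> lp_space p"
    and "lp_norm p (\<lambda>k. \<Sum>j. a j * z j k) \<le> (\<Sum>j. cmod (a j))"
    using lp_space_normI[OF p \<tau> bd] by (auto simp: \<tau>_def)
qed

text \<open>A bound on the operator norm of a functional on l_p. Both sides ignore the entries of
  \<open>y\<close> from \<open>K\<close> on, so no support condition or membership in l_p has to be
  carried along.\<close>

definition dual_bounded :: "real \<Rightarrow> cseq \<Rightarrow> real \<Rightarrow> bool" where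
  "dual_bounded p b M \<longleftrightarrow>
    (\<forall>K y. cmod (\<Sum>k<K. b k * y k) \<le> M * (\<Sum>k<K. cmod (y k) powr p) powr (1 / p))"

lemma dual_bounded_mono: "dual_bounded p b M \<Longrightarrow> M \<le> M' \<Longrightarrow> dual_bounded p b M'"
  unfolding dual_bounded_def by (meson mult_right_mono order_trans powr_ge_zero)

lemma dual_bounded_add:
  assumes "dual_bounded p b M" "dual_bounded p c M'"
  shows "dual_bounded p (\<lambda>k. b k + c k) (M + M')"
  unfolding dual_bounded_def
proof (intro allI)
  fix K and y :: cseq
  have "cmod (\<Sum>k<K. (b k + c k) * y k) \<le> cmod (\<Sum>k<K. b k * y k) + cmod (\<Sum>k<K. c k * y k)"
    by (simp add: distrib_right sum.distrib norm_triangle_ineq)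
  also have "\<dots> \<le> M * (\<Sum>k<K. cmod (y k) powr p) powr (1 / p) + M' * (\<Sum>k<K. cmod (y k) powr p) powr (1 / p)"
    using assms unfolding dual_bounded_def by (intro add_mono) blast+
  finally show "cmod (\<Sum>k<K. (b k + c k) * y k) \<le> (M + M') * (\<Sum>k<K. cmod (y k) powr p) powr (1 / p)"
    by (simp add: distrib_right)
qed

lemma dual_bounded_uminus: "dual_bounded p b M \<Longrightarrow> dual_bounded p (\<lambda>k. - b k) M"
  by (simp add: dual_bounded_def sum_negf)

text \<open>Rotating the phase of each \<open>y k\<close> makes every term nonnegative and leaves
  the right-hand side unchanged.\<close>

lemma dual_bounded_abs:
  assumes "dual_bounded p b M"
  shows "(\<Sum>k<K. cmod (b k * y k)) \<le> M * (\<Sum>k<K. cmod (y k) powr p) powr (1 / p)"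
proof -
  \<comment> \<open>Division by \<open>b k = 0\<close> would give 0 and spoil the equality of the
    moduli of \<open>y'\<close> and \<open>y\<close>.\<close>
  define y' where "y' k = (if b k = 0 then y k else of_real (cmod (b k * y k)) / b k)" for k
  have "b k * y' k = of_real (cmod (b k * y k))" for k by (simp add: y'_def)
  then have "(\<Sum>k<K. b k * y' k) = of_real (\<Sum>k<K. cmod (b k * y k))" by simp
  then have "cmod (\<Sum>k<K. b k * y' k) = (\<Sum>k<K. cmod (b k * y k))"
    by (simp only: norm_of_real) (simp add: sum_nonneg)
  moreover have "cmod (y' k) = cmod (y k)" for k by (simp add: y'_def norm_divide norm_mult)
  moreover have "cmod (\<Sum>k<K. b k * y' k) \<le> M * (\<Sum>k<K. cmod (y' k) powr p) powr (1 / p)"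
    using assms unfolding dual_bounded_def by blast
  ultimately show ?thesis by simp
qed

lemma dual_bounded_lp:
  assumes "dual_bounded p b M" "0 \<le> M" "0 < p" "y \<in> lp_space p"
  shows "summable (\<lambda>k. b k * y k)" and "cmod (\<Sum>k. b k * y k) \<le> M * lp_norm p y"
proof -
  have bd: "(\<Sum>k<K. cmod (b k * y k)) \<le> M * lp_norm p y" for K
    using dual_bounded_abs[OF assms(1)] lp_norm_partial_sum_le[OF assms(3,4)] assms(2)
    by (meson mult_left_mono order_trans)
  then have sm: "summable (\<lambda>k. cmod (b k * y k))"
    by (intro summableI_nonneg_bounded) auto
  then show "summable (\<lambda>k. b k * y k)" by (rule summable_norm_cancel)
  show "cmod (\<Sum>k. b k * y k) \<le> M * lp_norm p y"
    using summable_norm[OF sm] suminf_le_const[OF sm bd] by linarith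
qed

text \<open>A violating section is extended by zero and divided by its norm \<open>S\<close>; with
  \<open>S = 0\<close> both sides of the strict inequality would be 0. The vectors in the
  contradiction arguments below come from here.\<close>

lemma not_dual_boundedE:
  assumes "\<not> dual_bounded p b M" "0 < p"
  obtains K z where "\<And>k. k \<ge> K \<Longrightarrow> z k = 0" "z \<in> lp_space p" "lp_norm p z \<le> 1"
    "M < cmod (\<Sum>k<K. b k * z k)"
proof -
  from assms obtain K y where *: "M * (\<Sum>k<K. cmod (y k) powr p) powr (1 / p) < cmod (\<Sum>k<K. b k * y k)"
    by (auto simp: dual_bounded_def not_le)
  define S where "S = (\<Sum>k<K. cmod (y k) powr p) powr (1 / p)"
  have "S \<noteq> 0"
  proof
    assume "S = 0"
    then have "y k = 0" if "k < K" for k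
      using that assms(2) by (auto simp: S_def sum_nonneg_eq_0_iff)
    then have "(\<Sum>k<K. b k * y k) = 0" by simp
    with * \<open>S = 0\<close> show False by (simp add: S_def)
  qed
  then have S: "S > 0" unfolding S_def by (simp add: less_le)
  define x where "x k = (if k < K then y k else 0)" for k
  have x: "x \<in> lp_space p" "lp_norm p x = S"
    using lp_space_finite_support[of K x p] by (auto simp: x_def S_def)
  define z where "z k = of_real (1 / S) * x k" for k
  have z: "z \<in> lp_space p" "lp_norm p z \<le> 1"
    using lp_norm_cmult[OF assms(2) x(1), of "of_real (1 / S)"] x(2) S
    by (simp_all add: z_def[abs_def] norm_divide)
  have "(\<Sum>k<K. b k * z k) = of_real (1 / S) * (\<Sum>k<K. b k * y k)"
    by (simp add: z_def x_def sum_distrib_left mult_ac)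
  then have "cmod (\<Sum>k<K. b k * z k) = cmod (\<Sum>k<K. b k * y k) / S"
    using S by (simp add: norm_mult norm_divide)
  moreover have "M < cmod (\<Sum>k<K. b k * y k) / S"
    using * S by (simp add: S_def[symmetric] field_simps)
  ultimately show ?thesis
    using z by (intro that[of K z]) (auto simp: z_def x_def)
qed

text \<open>Young's inequality for the normalized f / F and g / G, summed termwise, gives the bound
  1/p + 1/q = 1.\<close>

lemma Holder_sum:
  fixes f g :: "'a \<Rightarrow> real"
  assumes "1 < p" "1 < q" "1 / p + 1 / q = 1" "\<And>i. i \<in> I \<Longrightarrow> 0 \<le> f i" "\<And>i. i \<in> I \<Longrightarrow> 0 \<le> g i"
  shows "(\<Sum>i\<in>I. f i * g i) \<le> (\<Sum>i\<in>I. f i powr p) powr (1 / p) * (\<Sum>i\<in>I. g i powr q) powr (1 / q)"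
proof (cases "finite I \<and> (\<Sum>i\<in>I. f i powr p) \<noteq> 0 \<and> (\<Sum>i\<in>I. g i powr q) \<noteq> 0")
  \<comment> \<open>If one factor sum vanishes, all products vanish; over an infinite index set all
    sums are 0 by convention.\<close>
  case False
  then have "(\<Sum>i\<in>I. f i * g i) = 0"
    using assms(1,2) by (cases "finite I") (auto simp: sum_nonneg_eq_0_iff intro!: sum.neutral)
  then show ?thesis by (auto)
next
  case True
  define F where "F = (\<Sum>i\<in>I. f i powr p) powr (1 / p)"
  define G where "G = (\<Sum>i\<in>I. g i powr q) powr (1 / q)"
  have pos: "F > 0" "G > 0" using True by (auto simp: F_def G_def less_le)
  have FG: "F powr p = (\<Sum>i\<in>I. f i powr p)" "G powr q = (\<Sum>i\<in>I. g i powr q)"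
    using assms(1,2) by (simp_all add: F_def G_def powr_powr sum_nonneg)
  have "(\<Sum>i\<in>I. f i / F * (g i / G)) \<le> (\<Sum>i\<in>I. (f i / F) powr p / p + (g i / G) powr q / q)"
    using assms pos by (intro sum_mono Youngs_inequality) auto
  also have "\<dots> = (\<Sum>i\<in>I. f i powr p / F powr p / p) + (\<Sum>i\<in>I. g i powr q / G powr q / q)"
    unfolding sum.distrib using assms pos
    by (intro arg_cong2[where f = "(+)"] sum.cong) (auto simp: powr_divide)
  also have "\<dots> = (\<Sum>i\<in>I. f i powr p) / F powr p / p + (\<Sum>i\<in>I. g i powr q) / G powr q / q"
    by (simp add: sum_divide_distrib)
  also have "\<dots> = 1"
    using True assms(3) by (simp add: FG)
  finally have "(\<Sum>i\<in>I. f i * g i) / (F * G) \<le> 1"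
    by (simp add: sum_divide_distrib)
  then show ?thesis using pos by (simp add: F_def[symmetric] G_def[symmetric])
qed

lemma elp_norm_le_iff_dual_bounded:
  assumes p: "1 < p" and q: "q = p / (p - 1)" and M: "0 \<le> M"
  shows "elp_norm q b \<le> ennreal M \<longleftrightarrow> dual_bounded p b M"
proof
  have q1: "1 < q" and pq: "1 / p + 1 / q = 1" using p by (auto simp: q field_simps)
  {
    assume "elp_norm q b \<le> ennreal M"
    then have b: "b \<in> lp_space q" "lp_norm q b \<le> M"
      using M by (auto simp: elp_norm_def top_unique split: if_splits)
    show "dual_bounded p b M"
      unfolding dual_bounded_def
    proof (intro allI)
      fix K and y :: cseq
      have "cmod (\<Sum>k<K. b k * y k) \<le> (\<Sum>k<K. cmod (b k) * cmod (y k))"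
        by (rule order_trans[OF norm_sum]) (simp add: norm_mult)
      also have "\<dots> \<le> (\<Sum>k<K. cmod (b k) powr q) powr (1 / q) * (\<Sum>k<K. cmod (y k) powr p) powr (1 / p)"
        using p q1 pq by (intro Holder_sum) (auto simp: add.commute)
      also have "\<dots> \<le> M * (\<Sum>k<K. cmod (y k) powr p) powr (1 / p)"
        using lp_norm_partial_sum_le[OF _ b(1), of K] b(2) q1 by (intro mult_right_mono) auto
      finally show "cmod (\<Sum>k<K. b k * y k) \<le> M * (\<Sum>k<K. cmod (y k) powr p) powr (1 / p)" .
    qed
  }
  {
    assume db: "dual_bounded p b M"
    have "(\<Sum>k<K. cmod (b k) powr q) \<le> M powr q" for K
    proof -
      define S where "S = (\<Sum>k<K. cmod (b k) powr q)"
      \<comment> \<open>The equality case of Holder's inequality: since (q - 1) p = q, both |y|^p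
        and |b| |y| equal |b|^q. Phases are absorbed by \<open>dual_bounded_abs\<close>.\<close>
      define y where "y k = complex_of_real (cmod (b k) powr (q - 1))" for k
      have "cmod (b k * y k) = cmod (b k) powr q" for k
        using powr_mult_base[of "cmod (b k)" "q - 1"] by (simp add: y_def norm_mult)
      moreover have "cmod (y k) powr p = cmod (b k) powr q" for k
      proof -
        have "(q - 1) * p = q" using p by (simp add: q field_simps)
        then show ?thesis by (simp add: y_def powr_powr)
      qed
      ultimately have "S \<le> M * S powr (1 / p)"
        using dual_bounded_abs[OF db, of y K] by (simp add: S_def)
      show ?thesis
      proof (cases "S = 0")
        case False
        then have "S > 0" by (auto simp: S_def less_le sum_nonneg)
        \<comment> \<open>Cancelling \<open>S powr (1 / p)\<close> leaves the l_q norm of the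
          section, bounded by \<open>M\<close> uniformly in \<open>K\<close>.\<close>
        have "S powr (1 / q) * S powr (1 / p) = S"
          using pq \<open>S > 0\<close> by (simp add: add.commute flip: powr_add)
        with \<open>S \<le> M * S powr (1 / p)\<close> \<open>S > 0\<close> have "S powr (1 / q) \<le> M"
          by (metis mult_le_cancel_right powr_gt_zero less_numeral_extra(3) not_less order_less_le)
        then have "(S powr (1 / q)) powr q \<le> M powr q" using q1 by (intro powr_mono2) auto
        then show ?thesis using q1 \<open>S > 0\<close> by (simp add: powr_powr S_def)
      qed (simp add: S_def)
    qed
    then have "b \<in> lp_space q" "lp_norm q b \<le> M"
      using q1 M lp_space_normI[of q M b] by auto
    then show "elp_norm q b \<le> ennreal M" by (simp add: elp_norm_def ennreal_leI)
  }
qed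

lemma esup_norm_le_iff_dual_bounded:
  assumes M: "0 \<le> M"
  shows "esup_norm b \<le> ennreal M \<longleftrightarrow> dual_bounded 1 b M"
proof -
  have "esup_norm b \<le> ennreal M \<longleftrightarrow> (\<forall>k. cmod (b k) \<le> M)"
    using M by (simp add: esup_norm_def SUP_le_iff)
  also have "\<dots> \<longleftrightarrow> dual_bounded 1 b M"
  proof
    assume b: "\<forall>k. cmod (b k) \<le> M"
    show "dual_bounded 1 b M"
      unfolding dual_bounded_def
    proof (intro allI)
      fix K and y :: cseq
      have "cmod (\<Sum>k<K. b k * y k) \<le> (\<Sum>k<K. M * cmod (y k))"
        using b by (intro sum_norm_le) (simp add: norm_mult mult_right_mono)
      then show "cmod (\<Sum>k<K. b k * y k) \<le> M * (\<Sum>k<K. cmod (y k) powr 1) powr (1 / 1)"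
        by (simp add: sum_nonneg sum_distrib_left)
    qed
  next
    assume db: "dual_bounded 1 b M"
    show "\<forall>k. cmod (b k) \<le> M"
    proof
      fix k :: nat
      define e where "e j = (if j = k then 1 else 0 :: complex)" for j
      have "cmod (\<Sum>j<Suc k. b j * e j) \<le> M * (\<Sum>j<Suc k. cmod (e j) powr 1) powr (1 / 1)"
        using db unfolding dual_bounded_def by blast
      moreover have "(\<Sum>j<Suc k. b j * e j) = b k" by (simp add: e_def)
      moreover have "(\<Sum>j<Suc k. cmod (e j) powr 1) = 1" by (simp add: e_def)
      ultimately show "cmod (b k) \<le> M" by simp
    qed
  qed
  finally show ?thesis .
qed

section \<open>Uniform boundedness and the hat matrix\<close>

text \<open>Instead of the exact operator norm, the grid \<open>(5 / 4) ^ i * m\<close> is searched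
  for a point \<open>M\<close> where the bound fails but holds at the next point. Any ratio strictly
  between 1 and 2 would do in the later estimate, where a remainder costs half of this
  ratio.\<close>

lemma dual_bounded_near_optimal:
  assumes "0 < p" "0 < m" "\<not> dual_bounded p b m" "dual_bounded p b C"
  obtains M z where "m \<le> M" "dual_bounded p b (5 / 4 * M)" "z \<in> lp_space p" "lp_norm p z \<le> 1"
    "M < cmod (\<Sum>k. b k * z k)"
proof -
  define P where "P i \<longleftrightarrow> dual_bounded p b ((5 / 4) ^ i * m)" for i :: nat
  obtain i where "C / m < (5 / 4) ^ i" using real_arch_pow[of "5 / 4" "C / m"] by auto
  then have "C \<le> (5 / 4) ^ i * m" using assms(2) by (simp add: field_simps)
  then have "P i" using assms(4) dual_bounded_mono by (auto simp: P_def)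
  moreover have "\<not> P 0" using assms(3) by (simp add: P_def)
  ultimately obtain j where j: "\<not> P j" "P (Suc j)"
    using ex_least_nat_less[of P i] by auto
  define M where "M = (5 / 4) ^ j * m"
  from j(1) obtain K z where z: "\<And>k. k \<ge> K \<Longrightarrow> z k = 0" "z \<in> lp_space p" "lp_norm p z \<le> 1"
      "M < cmod (\<Sum>k<K. b k * z k)"
    using not_dual_boundedE[OF _ assms(1), of b M] by (auto simp: P_def M_def)
  have "(\<Sum>k. b k * z k) = (\<Sum>k<K. b k * z k)"
    using z(1) by (intro suminf_finite) (auto simp: not_less)
  with z have "M < cmod (\<Sum>k. b k * z k)" by simp
  moreover have "m \<le> M" using assms(2) by (simp add: M_def)
  moreover have "dual_bounded p b (5 / 4 * M)" using j(2) by (simp add: P_def M_def mult.assoc)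
  ultimately show ?thesis using z(2,3) by (intro that[of M z])
qed

text \<open>Sokal's proof: only the signs of the terms of a geometrically decaying series of
  near-optimal vectors have to be chosen, so the Baire category theorem is not needed.\<close>

lemma uniform_boundedness_lp:
  fixes c :: "'i \<Rightarrow> cseq"
  assumes p: "1 \<le> p"
    and db: "\<And>i. \<exists>C\<ge>0. dual_bounded p (c i) C"
    and ptw: "\<And>y. y \<in> lp_space p \<Longrightarrow> \<exists>B. \<forall>i. cmod (\<Sum>k. c i k * y k) \<le> B"
  shows "\<exists>M\<ge>0. \<forall>i. dual_bounded p (c i) M"
proof (rule ccontr)
  assume "\<not> ?thesis"
  then have unb: "\<exists>i. \<not> dual_bounded p (c i) M" if "0 \<le> M" for M using that by blast
  have p0: "0 < p" using p by simp
  \<comment> \<open>Norms of size at least 4^m outgrow the step lengths 3^(-m) used below, leaving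
    growth (4/3)^m.\<close>
  define Q where "Q m i M z \<longleftrightarrow> 4 ^ m \<le> M \<and> dual_bounded p (c i) (5 / 4 * M) \<and> z \<in> lp_space p \<and>
      lp_norm p z \<le> 1 \<and> M < cmod (\<Sum>k. c i k * z k)" for m :: nat and i M z
  have "\<exists>i M z. Q m i M z" for m
  proof -
    obtain i where i: "\<not> dual_bounded p (c i) (4 ^ m)" using unb[of "4 ^ m"] by auto
    obtain C where "dual_bounded p (c i) C" using db by blast
    then obtain M z where "4 ^ m \<le> M" "dual_bounded p (c i) (5 / 4 * M)" "z \<in> lp_space p"
        "lp_norm p z \<le> 1" "M < cmod (\<Sum>k. c i k * z k)"
      by (rule dual_bounded_near_optimal[OF p0 _ i, rotated]) auto
    then show ?thesis unfolding Q_def by blast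
  qed
  then obtain i M z where "\<And>m. Q m (i m) (M m) (z m)" by metis
  then have M: "\<And>m. 4 ^ m \<le> M m"
    and dbM: "\<And>m. dual_bounded p (c (i m)) (5 / 4 * M m)"
    and z: "\<And>m. z m \<in> lp_space p" "\<And>m. lp_norm p (z m) \<le> 1"
    and Mz: "\<And>m. M m < cmod (\<Sum>k. c (i m) k * z m k)"
    unfolding Q_def by blast+
  have M0: "0 < M m" for m using M[of m] by (rule less_le_trans[rotated]) simp
  define T where "T m y = (\<Sum>k. c (i m) k * y k)" for m and y :: cseq
  have smT: "summable (\<lambda>k. c (i m) k * y k)" if "y \<in> lp_space p" for m y
    using dual_bounded_lp(1)[OF dbM _ p0 that] M0[of m] by simp
  have T_add: "T m (\<lambda>k. x k + y k) = T m x + T m y" if "x \<in> lp_space p" "y \<in> lp_space p" for m x y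
    using smT that by (simp add: T_def distrib_left suminf_add)
  have T_cmult: "T m (\<lambda>k. a * x k) = a * T m x" if "x \<in> lp_space p" for m a x
    using smT[OF that, of m] by (simp add: T_def mult.left_commute suminf_mult)

  define P where "P m x \<longleftrightarrow> M m / 3 ^ m \<le> cmod (T m (\<lambda>k. x k + 1 / 3 ^ m * z m k))" for m x
  \<comment> \<open>The recursion carries the whole partial sum because the sign of the next term
    depends on it.\<close>
  define x where "x = rec_nat (\<lambda>_. 0) (\<lambda>m v k. v k + (if P m v then 1 else -1) / 3 ^ m * z m k)"
  define a where "a m = (if P m (x m) then 1 else -1) / (3::complex) ^ m" for m
  have x_Suc: "x (Suc m) = (\<lambda>k. x m k + a m * z m k)" for m by (simp add: x_def a_def)
  have x_eq: "x m k = (\<Sum>j<m. a j * z j k)" for m k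
    by (induction m) (simp_all add: x_Suc, simp add: x_def)
  have x_lp: "x m \<in> lp_space p" for m
  proof (induction m)
    case 0 show ?case by (simp add: x_def lp_space_def)
  next
    case (Suc m)
    then show ?case unfolding x_Suc by (intro lp_space_add lp_norm_cmult(1) p0 z(1))
  qed
  have T_x: "M m / 3 ^ m \<le> cmod (T m (x (Suc m)))" for m
  proof (cases "P m (x m)")
    case True
    then show ?thesis by (simp add: x_Suc a_def P_def)
  next
    case False
    define u where "u = T m (x m)"
    define v where "v = 1 / 3 ^ m * T m (z m)"
    have "cmod (u + v) < M m / 3 ^ m"
      using False T_add[OF x_lp lp_norm_cmult(1)[OF p0 z(1)], of m m "1 / 3 ^ m" m]
        T_cmult[OF z(1), of m "1 / 3 ^ m" m] by (simp add: P_def u_def v_def)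
    moreover have "T m (x (Suc m)) = u - v"
      using False T_add[OF x_lp lp_norm_cmult(1)[OF p0 z(1)], of m m "a m" m]
        T_cmult[OF z(1), of m "a m" m] by (simp add: x_Suc u_def v_def a_def)
    moreover have "M m / 3 ^ m < cmod v"
      using Mz[of m] by (simp add: v_def T_def norm_mult norm_divide norm_power divide_strict_right_mono)
    \<comment> \<open>The two candidates differ by 2 v, so if one is smaller than |v|, the other is
      larger.\<close>
    moreover have "2 * cmod v \<le> cmod (u + v) + cmod (u - v)"
      using norm_triangle_ineq4[of "u + v" "u - v"] by (simp add: norm_mult flip: mult_2)
    ultimately show ?thesis by simp
  qed

  have a_norm: "cmod (a j) = (1 / 3) ^ j" for j
    by (simp add: a_def norm_divide norm_power power_one_over)
  then have a_sm: "summable (\<lambda>j. cmod (a (j + n)))" for n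
    by (subst summable_iff_shift) (simp add: a_norm summable_geometric)
  define X where "X k = (\<Sum>j. a j * z j k)" for k
  have X_lp: "X \<in> lp_space p"
    unfolding X_def[abs_def] using lp_norm_suminf_le(2)[OF p z, of a] a_sm[of 0] by simp
  \<comment> \<open>The remainder of \<open>X\<close> after term \<open>m\<close>; the powers 3^(-j)
    with j > m add up to half of 3^(-m).\<close>
  define w where "w m k = (\<Sum>j. a (j + Suc m) * z (j + Suc m) k)" for m k
  have w_lp: "w m \<in> lp_space p" and w_le: "lp_norm p (w m) \<le> (1 / 3) ^ m / 2" for m
  proof -
    have "(\<Sum>j. cmod (a (j + Suc m))) = (\<Sum>j. (1 / 3) ^ Suc m * (1 / 3 :: real) ^ j)"
      by (simp add: a_norm power_add mult_ac)
    also have "\<dots> = (1 / 3) ^ m / 2"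
      by (subst suminf_mult) (simp_all add: summable_geometric suminf_geometric)
    finally show "w m \<in> lp_space p" "lp_norm p (w m) \<le> (1 / 3) ^ m / 2"
      unfolding w_def[abs_def]
      using a_sm[of "Suc m"]
        lp_norm_suminf_le(2,3)[OF p, of "\<lambda>j. z (j + Suc m)" "\<lambda>j. a (j + Suc m)"] z
      by auto
  qed
  have X_split: "X = (\<lambda>k. x (Suc m) k + w m k)" for m
  proof
    fix k
    have "summable (\<lambda>j. a j * z j k)"
      using lp_norm_suminf_le(1)[OF p z, of a] a_sm[of 0] by simp
    then show "X k = x (Suc m) k + w m k"
      using suminf_split_initial_segment[of "\<lambda>j. a j * z j k" "Suc m"]
      by (simp add: X_def w_def x_eq add.commute)
  qed
  \<comment> \<open>Here 3/8 = 1 - 5/8: the partial sum through term \<open>m\<close> contributes at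
    least \<open>M m / 3 ^ m\<close>, and the remainder takes away at most 5/4 * 1/2 of
    that.\<close>
  have big: "3 / 8 * (4 / 3) ^ m \<le> cmod (T m X)" for m
  proof -
    have "cmod (T m (w m)) \<le> 5 / 4 * M m * lp_norm p (w m)"
      unfolding T_def using M0[of m] by (intro dual_bounded_lp(2) dbM w_lp p0) auto
    also have "\<dots> \<le> 5 / 4 * M m * ((1 / 3) ^ m / 2)"
      using w_le M0[of m] by (intro mult_left_mono) auto
    finally have "cmod (T m (w m)) \<le> 5 / 8 * (M m / 3 ^ m)"
      by (simp add: power_one_over)
    moreover have "T m X = T m (x (Suc m)) + T m (w m)"
      unfolding X_split[of m] by (rule T_add[OF x_lp w_lp])
    ultimately have "3 / 8 * (M m / 3 ^ m) \<le> cmod (T m X)"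
      using T_x[of m] norm_diff_ineq[of "T m (x (Suc m))" "T m (w m)"] by simp
    moreover have "(4 / 3) ^ m \<le> M m / 3 ^ m"
      using M[of m] by (simp add: power_divide divide_right_mono)
    ultimately show ?thesis by simp
  qed
  obtain B where B: "\<And>j. cmod (\<Sum>k. c j k * X k) \<le> B" using ptw[OF X_lp] by blast
  obtain m where "8 / 3 * B < (4 / 3) ^ m" using real_arch_pow[of "4 / 3" "8 / 3 * B"] by auto
  with B[of "i m"] big[of m] show False by (simp add: T_def)
qed

section \<open>Representation of functionals on the difference space\<close>

lemma dual_bounded_finite_support:
  assumes "0 < p" "\<And>k. k \<ge> J \<Longrightarrow> c k = 0"
  shows "\<exists>C\<ge>0. dual_bounded p c C"
proof (intro exI conjI)
  show "0 \<le> (\<Sum>k<J. cmod (c k))" by (simp add: sum_nonneg)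
  show "dual_bounded p c (\<Sum>k<J. cmod (c k))"
    unfolding dual_bounded_def
  proof (intro allI)
    fix K and y :: cseq
    define S where "S = (\<Sum>k<K. cmod (y k) powr p) powr (1 / p)"
    have y: "cmod (y k) \<le> S" if "k < K" for k
    proof -
      have "(cmod (y k) powr p) powr (1 / p) \<le> S"
        unfolding S_def using that assms(1)
        by (intro powr_mono2) (auto intro: member_le_sum[of k "{..<K}" "\<lambda>k. cmod (y k) powr p"])
      then show ?thesis using assms(1) by (simp add: powr_powr)
    qed
    have "cmod (\<Sum>k<K. c k * y k) \<le> (\<Sum>k<K. cmod (c k) * S)"
      using y by (intro sum_norm_le) (simp add: norm_mult mult_left_mono)
    also have "\<dots> = (\<Sum>k<K. cmod (c k)) * S" by (simp add: sum_distrib_right)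
    also have "\<dots> \<le> (\<Sum>k<J. cmod (c k)) * S"
    proof (rule mult_right_mono)
      have "(\<Sum>k<K. cmod (c k)) = (\<Sum>k\<in>{..<K} \<inter> {..<J}. cmod (c k))"
        by (intro sum.mono_neutral_right) (auto, metis assms(2) not_le)
      also have "\<dots> \<le> (\<Sum>k<J. cmod (c k))" by (intro sum_mono2) auto
      finally show "(\<Sum>k<K. cmod (c k)) \<le> (\<Sum>k<J. cmod (c k))" .
    qed (simp add: S_def)
    finally show "cmod (\<Sum>k<K. c k * y k) \<le> (\<Sum>k<J. cmod (c k)) * (\<Sum>k<K. cmod (y k) powr p) powr (1 / p)"
      by (simp add: S_def)
  qed
qed

lemma lp_norm_tail_tendsto_0:
  assumes "0 < p" "y \<in> lp_space p"
  shows "(\<lambda>K. lp_norm p (\<lambda>k. if k < K then 0 else y k)) \<longlonglongrightarrow> 0"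
proof -
  have sm: "summable (\<lambda>k. cmod (y k) powr p)" using assms by (simp add: lp_space_def)
  have eq: "lp_norm p (\<lambda>k. if k < K then 0 else y k) = (\<Sum>k. cmod (y (k + K)) powr p) powr (1 / p)" for K
  proof -
    have "summable (\<lambda>k. cmod (if k < K then 0 else y k) powr p)"
      by (rule summable_comparison_test'[OF sm, of 0]) auto
    from suminf_split_initial_segment[OF this, of K] show ?thesis
      by (simp add: lp_norm_def)
  qed
  have "(\<lambda>K. \<Sum>k. cmod (y (k + K)) powr p) \<longlonglongrightarrow> 0"
    using suminf_exist_split2[OF sm] .
  then have "(\<lambda>K. (\<Sum>k. cmod (y (k + K)) powr p) powr (1 / p)) \<longlonglongrightarrow> 0 powr (1 / p)"
    using assms(1) by (intro tendsto_powr') (auto intro!: always_eventually suminf_nonneg summable_ignore_initial_segment sm)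
  then show ?thesis by (simp add: eq)
qed

text \<open>The partial sums of a series \<open>\<Sum>j. a j * x j\<close>, as functionals of \<open>y = frac_diff \<alpha> x\<close>.\<close>

definition hat_partial :: "real \<Rightarrow> cseq \<Rightarrow> nat \<Rightarrow> cseq" where
  "hat_partial \<alpha> a J k = (\<Sum>i<J - k. complex_of_real (frac_coeff (-\<alpha>) i) * a (k + i))"

text \<open>The finite triangle is summed in the other order; writing j = k + i < J restricts the
  inner index to i < J - k, which explains the cut-off in \<open>hat_partial\<close>.\<close>

lemma sum_mult_frac_diff:
  "(\<Sum>j<J. a j * frac_diff (-\<alpha>) y j) = (\<Sum>k<J. hat_partial \<alpha> a J k * y k)"
proof -
  let ?g = "\<lambda>i k. a (k + i) * complex_of_real (frac_coeff (-\<alpha>) i) * y k"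
  have "(\<Sum>j<J. a j * frac_diff (-\<alpha>) y j) = (\<Sum>j<J. \<Sum>i\<le>j. ?g i (j - i))"
    by (simp add: frac_diff_def sum_distrib_left mult.assoc)
  also have "\<dots> = (\<Sum>(i, k)\<in>{(i, k). i + k < J}. ?g i k)"
    by (rule sum.triangle_reindex[symmetric])
  also have "\<dots> = (\<Sum>(k, i)\<in>(SIGMA k:{..<J}. {..<J - k}). ?g i k)"
    by (rule sum.reindex_bij_witness[of _ prod.swap prod.swap]) auto
  also have "\<dots> = (\<Sum>k<J. \<Sum>i<J - k. ?g i k)"
    by (rule sum.Sigma[symmetric]) auto
  also have "\<dots> = (\<Sum>k<J. hat_partial \<alpha> a J k * y k)"
    by (simp add: hat_partial_def sum_distrib_left mult_ac)
  finally show ?thesis .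
qed

lemma lp_diff_spaceI:
  assumes "\<alpha> \<notin> \<int>" "y \<in> lp_space p"
  shows "frac_diff (-\<alpha>) y \<in> lp_diff_space \<alpha> p"
  using assms by (simp add: lp_diff_space_def frac_diff_inverse)

text \<open>The partial sums converge at every \<open>y\<close>, so uniform boundedness gives one
  \<open>M\<close> for all of them, and entrywise limits transfer it to \<open>b\<close>. The value
  at \<open>y\<close> then differs from the K-th partial sum of the b-series by at most
  \<open>M\<close> times the norm of the tail of \<open>y\<close>.\<close>

lemma functional_lp_diff_space:
  assumes \<alpha>: "\<alpha> \<notin> \<int>" and p: "1 \<le> p"
    and conv: "\<And>x. x \<in> lp_diff_space \<alpha> p \<Longrightarrow> summable (\<lambda>k. a k * x k)"
  defines "b \<equiv> (\<lambda>k. \<Sum>i. complex_of_real (frac_coeff (-\<alpha>) i) * a (k + i))"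
  shows "\<exists>C\<ge>0. dual_bounded p b C"
    and "\<And>x. x \<in> lp_diff_space \<alpha> p \<Longrightarrow> (\<lambda>k. b k * frac_diff \<alpha> x k) sums (\<Sum>k. a k * x k)"
proof -
  have p0: "0 < p" using p by simp
  let ?c = "hat_partial \<alpha> a"
  define f where "f y = (\<Sum>j. a j * frac_diff (-\<alpha>) y j)" for y
  have c0: "?c J k = 0" if "k \<ge> J" for J k using that by (simp add: hat_partial_def)
  have c_sum: "(\<Sum>k. ?c J k * y k) = (\<Sum>k<J. ?c J k * y k)" for J and y
    using c0 by (intro suminf_finite) (auto simp: not_less)
  have f: "(\<lambda>J. \<Sum>k. ?c J k * y k) \<longlonglongrightarrow> f y" if "y \<in> lp_space p" for y
    using summable_LIMSEQ[OF conv[OF lp_diff_spaceI[OF \<alpha> that]]]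
    by (simp add: f_def c_sum sum_mult_frac_diff)
  have "\<exists>M\<ge>0. \<forall>J. dual_bounded p (?c J) M"
  proof (rule uniform_boundedness_lp[OF p])
    show "\<exists>C\<ge>0. dual_bounded p (?c J) C" for J
      by (rule dual_bounded_finite_support[OF p0]) (rule c0)
    show "\<exists>B. \<forall>J. cmod (\<Sum>k. ?c J k * y k) \<le> B" if "y \<in> lp_space p" for y
      using convergent_imp_Bseq[OF convergentI[OF f[OF that]]] by (auto simp: Bseq_def)
  qed
  then obtain M where M: "0 \<le> M" "\<And>J. dual_bounded p (?c J) M" by blast
  have c_lim: "(\<lambda>J. ?c J k) \<longlonglongrightarrow> b k" for k
  proof -
    \<comment> \<open>Testing on a unit vector is what shows that the series defining
      \<open>b k\<close> converges.\<close>
    define e where "e j = (if j = k then 1 else 0 :: complex)" for j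
    have "e \<in> lp_space p" by (rule lp_space_finite_support(1)[of "Suc k"]) (simp add: e_def)
    then have "convergent (\<lambda>J. \<Sum>j. ?c J j * e j)" using f by (auto simp: convergent_def)
    moreover have "(\<Sum>j. ?c J j * e j) = ?c J k" for J
      using suminf_finite[of "{k}" "\<lambda>j. ?c J j * e j"] by (simp add: e_def)
    ultimately have "convergent (\<lambda>J. ?c J k)" by simp
    \<comment> \<open>After the shift by \<open>k\<close> the entry is exactly the J-th partial sum
      of that series.\<close>
    then have "convergent (\<lambda>J. ?c (J + k) k)"
      by (subst convergent_ignore_initial_segment[of "\<lambda>J. ?c J k"])
    then have "summable (\<lambda>i. complex_of_real (frac_coeff (-\<alpha>) i) * a (k + i))"
      by (simp add: hat_partial_def summable_iff_convergent)
    from summable_LIMSEQ[OF this] have "(\<lambda>J. ?c (J + k) k) \<longlonglongrightarrow> b k"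
      by (simp add: hat_partial_def b_def)
    then show ?thesis by (rule LIMSEQ_offset)
  qed
  have db: "dual_bounded p b M"
    unfolding dual_bounded_def
  proof (intro allI)
    fix K and y :: cseq
    have "(\<lambda>J. cmod (\<Sum>k<K. ?c J k * y k)) \<longlonglongrightarrow> cmod (\<Sum>k<K. b k * y k)"
      by (intro tendsto_norm tendsto_sum tendsto_mult c_lim tendsto_const)
    then show "cmod (\<Sum>k<K. b k * y k) \<le> M * (\<Sum>k<K. cmod (y k) powr p) powr (1 / p)"
      by (rule LIMSEQ_le_const2) (use M(2) in \<open>auto simp: dual_bounded_def\<close>)
  qed
  with M(1) show "\<exists>C\<ge>0. dual_bounded p b C" by blast
  fix x assume x: "x \<in> lp_diff_space \<alpha> p"
  define y where "y = frac_diff \<alpha> x"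
  have y: "y \<in> lp_space p" using x by (simp add: lp_diff_space_def y_def)
  have "-\<alpha> \<notin> \<int>" using \<alpha> by simp
  then have xy: "x = frac_diff (-\<alpha>) y" using frac_diff_inverse[of "-\<alpha>" x] by (simp add: y_def)
  \<comment> \<open>The limit in \<open>J\<close> is taken first, at fixed \<open>K\<close>: the
    error bound does not involve \<open>J\<close>, and afterwards tends to 0 in
    \<open>K\<close>.\<close>
  have "(\<lambda>K. f y - (\<Sum>k<K. b k * y k)) \<longlonglongrightarrow> 0"
  proof (rule Lim_null_comparison)
    let ?t = "\<lambda>K k. if k < K then 0 else y k"
    show "(\<lambda>K. M * lp_norm p (?t K)) \<longlonglongrightarrow> 0"
      using tendsto_mult_left[OF lp_norm_tail_tendsto_0[OF p0 y], of M] by simp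
    have "cmod (f y - (\<Sum>k<K. b k * y k)) \<le> M * lp_norm p (?t K)" for K
    proof (rule LIMSEQ_le_const2)
      show "(\<lambda>J. cmod ((\<Sum>k. ?c J k * y k) - (\<Sum>k<K. ?c J k * y k))) \<longlonglongrightarrow> cmod (f y - (\<Sum>k<K. b k * y k))"
        by (intro tendsto_norm tendsto_diff tendsto_sum tendsto_mult c_lim tendsto_const f y)
      have t: "?t K \<in> lp_space p"
      proof -
        have "summable (\<lambda>k. cmod (?t K k) powr p)"
          by (rule summable_comparison_test'[of "\<lambda>k. cmod (y k) powr p" 0])
            (use y in \<open>auto simp: lp_space_def\<close>)
        then show ?thesis by (simp add: lp_space_def)
      qed
      have "cmod ((\<Sum>k. ?c J k * y k) - (\<Sum>k<K. ?c J k * y k)) \<le> M * lp_norm p (?t K)" for J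
      proof -
        have sm: "summable (\<lambda>k. ?c J k * y k)" "summable (\<lambda>k. ?c J k * ?t K k)"
          by (rule dual_bounded_lp(1)[OF M(2,1) p0 y], rule dual_bounded_lp(1)[OF M(2,1) p0 t])
        have "(\<Sum>k. ?c J k * ?t K k) = (\<Sum>k. ?c J k * y k) - (\<Sum>k<K. ?c J k * y k)"
          using suminf_split_initial_segment[OF sm(1), of K] suminf_split_initial_segment[OF sm(2), of K]
          by simp
        then show ?thesis using dual_bounded_lp(2)[OF M(2,1) p0 t, of J] by simp
      qed
      then show "\<exists>N. \<forall>J\<ge>N. cmod ((\<Sum>k. ?c J k * y k) - (\<Sum>k<K. ?c J k * y k)) \<le> M * lp_norm p (?t K)"
        by blast
    qed
    then show "\<forall>\<^sub>F K in sequentially. cmod (f y - (\<Sum>k<K. b k * y k)) \<le> M * lp_norm p (?t K)" by simp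
  qed
  then have "(\<lambda>K. \<Sum>k<K. b k * y k) \<longlonglongrightarrow> f y"
    using tendsto_diff[OF tendsto_const[of "f y"]] by fastforce
  then show "(\<lambda>k. b k * frac_diff \<alpha> x k) sums (\<Sum>k. a k * x k)"
    by (simp add: sums_def f_def flip: y_def xy)
qed

section \<open>Compactness\<close>

lemma linear_between_mat_apply:
  assumes "A \<in> matrix_class X Y"
  shows "linear_between X Y (mat_apply A)"
  using assms
  by (auto simp: linear_between_def matrix_class_def mat_apply_def distrib_left suminf_add
      mult.left_commute suminf_mult)

lemma mat_apply_eq_hat_matrix:
  assumes "\<alpha> \<notin> \<int>" "1 \<le> p" "A \<in> matrix_class (lp_diff_space \<alpha> p) Y"
  shows "\<exists>C\<ge>0. dual_bounded p (hat_matrix \<alpha> A n) C"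
    and "x \<in> lp_diff_space \<alpha> p \<Longrightarrow> (\<lambda>k. hat_matrix \<alpha> A n k * frac_diff \<alpha> x k) sums mat_apply A x n"
  using functional_lp_diff_space[OF assms(1,2), of "A n"] assms(3)
  by (auto simp: matrix_class_def hat_matrix_def mat_apply_def)

lemma mat_apply_finite_support:
  assumes "\<alpha> \<notin> \<int>" "1 \<le> p" "A \<in> matrix_class (lp_diff_space \<alpha> p) Y"
    and z: "\<And>k. k \<ge> K \<Longrightarrow> z k = 0"
  shows "mat_apply A (frac_diff (-\<alpha>) z) n = (\<Sum>k<K. hat_matrix \<alpha> A n k * z k)"
proof -
  have "(\<lambda>k. hat_matrix \<alpha> A n k * z k) sums mat_apply A (frac_diff (-\<alpha>) z) n"
    using mat_apply_eq_hat_matrix(2)[OF assms(1-3) lp_diff_spaceI[OF assms(1) lp_space_finite_support(1)[of K z, OF z]], of n]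
    by (simp add: frac_diff_inverse assms(1))
  moreover have "(\<lambda>k. hat_matrix \<alpha> A n k * z k) sums (\<Sum>k<K. hat_matrix \<alpha> A n k * z k)"
    using z by (intro sums_finite) auto
  ultimately show ?thesis by (rule sums_unique2)
qed

text \<open>Column \<open>k\<close> is the image of the sequence whose fractional difference is the
  k-th unit vector. For the target c this makes \<open>hat_limit\<close> a genuine limit, for c0 it
  makes that limit 0.\<close>

lemma hat_matrix_column:
  assumes "\<alpha> \<notin> \<int>" "1 \<le> p" "A \<in> matrix_class (lp_diff_space \<alpha> p) Y"
  shows "(\<lambda>n. hat_matrix \<alpha> A n k) \<in> Y"
proof -
  define e where "e j = (if j = k then 1 else 0 :: complex)" for j
  have e: "e j = 0" if "j \<ge> Suc k" for j using that by (simp add: e_def)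
  have "frac_diff (-\<alpha>) e \<in> lp_diff_space \<alpha> p"
    using lp_diff_spaceI[OF assms(1) lp_space_finite_support(1)[of "Suc k" e, OF e]] .
  then have "mat_apply A (frac_diff (-\<alpha>) e) \<in> Y" using assms(3) by (simp add: matrix_class_def)
  moreover have "mat_apply A (frac_diff (-\<alpha>) e) n = hat_matrix \<alpha> A n k" for n
  proof -
    have "mat_apply A (frac_diff (-\<alpha>) e) n = (\<Sum>j<Suc k. hat_matrix \<alpha> A n j * e j)"
      by (rule mat_apply_finite_support[OF assms]) (rule e)
    then show ?thesis by (simp add: e_def)
  qed
  ultimately show ?thesis by (metis ext)
qed

lemma mat_apply_bounded:
  assumes "\<alpha> \<notin> \<int>" "1 \<le> p" "A \<in> matrix_class (lp_diff_space \<alpha> p) Y"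
    and u: "\<And>m. u m \<in> lp_diff_space \<alpha> p" "\<And>m. lp_diff_norm \<alpha> p (u m) \<le> B"
  shows "bounded (range (\<lambda>m. mat_apply A (u m) n))"
proof -
  obtain C where C: "C \<ge> 0" "dual_bounded p (hat_matrix \<alpha> A n) C"
    using mat_apply_eq_hat_matrix(1)[OF assms(1-3)] by blast
  have "cmod (mat_apply A (u m) n) \<le> C * B" for m
  proof -
    have "mat_apply A (u m) n = (\<Sum>k. hat_matrix \<alpha> A n k * frac_diff \<alpha> (u m) k)"
      using mat_apply_eq_hat_matrix(2)[OF assms(1-3) u(1)] by (simp add: sums_iff)
    also have "cmod \<dots> \<le> C * lp_norm p (frac_diff \<alpha> (u m))"
      using u(1)[of m] assms(2) C by (intro dual_bounded_lp(2)) (auto simp: lp_diff_space_def)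
    also have "\<dots> \<le> C * B"
      using u(2)[of m] C(1) by (intro mult_left_mono) (auto simp: lp_diff_norm_def)
    finally show ?thesis .
  qed
  then show ?thesis by (auto simp: bounded_iff)
qed

section \<open>Compactness with values in c and c0\<close>

lemma cmod_le_sup_norm:
  assumes "convergent x"
  shows "cmod (x n) \<le> sup_norm x"
proof -
  have "bdd_above (range (\<lambda>k. cmod (x k)))"
    using convergent_imp_Bseq[OF assms] by (auto simp: Bseq_def bdd_above_def)
  then show ?thesis unfolding sup_norm_def by (rule cSUP_upper[rotated]) simp
qed

text \<open>Failure provides unit ball vectors whose images differ by more than \<epsilon> from
  their own limits at some index beyond \<open>r\<close>. A subsequential limit \<open>y\<close> of
  the images converges, so it is nearly constant far out, and an image close to \<open>y\<close> in
  sup norm must be so too.\<close>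

lemma compact_imp_uniformly_small:
  assumes \<alpha>: "\<alpha> \<notin> \<int>" and p: "1 \<le> p" and Y: "Y \<subseteq> c_space"
    and A: "A \<in> matrix_class (lp_diff_space \<alpha> p) Y"
    and \<beta>: "\<And>k. (\<lambda>n. hat_matrix \<alpha> A n k) \<longlonglongrightarrow> \<beta> k"
    and compact: "compact_operator (lp_diff_space \<alpha> p) (lp_diff_norm \<alpha> p) Y sup_norm (mat_apply A)"
    and "0 < \<epsilon>"
  shows "\<exists>r. \<forall>n\<in>{r..}. dual_bounded p (\<lambda>k. hat_matrix \<alpha> A n k - \<beta> k) \<epsilon>"
proof (rule ccontr)
  assume neg: "\<not> ?thesis"
  have p0: "0 < p" using p by simp
  define Q where "Q r n K z \<longleftrightarrow> r \<le> n \<and> (\<forall>k\<ge>K. z k = 0) \<and> z \<in> lp_space p \<and> lp_norm p z \<le> 1 \<and>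
    \<epsilon> < cmod (\<Sum>k<K. (hat_matrix \<alpha> A n k - \<beta> k) * z k)" for r n K :: nat and z
  have "\<exists>n K z. Q r n K z" for r
  proof -
    from neg obtain n where n: "n \<ge> r" "\<not> dual_bounded p (\<lambda>k. hat_matrix \<alpha> A n k - \<beta> k) \<epsilon>"
      by auto
    show ?thesis
      by (rule not_dual_boundedE[OF n(2) p0]) (use n(1) in \<open>auto simp: Q_def\<close>)
  qed
  then obtain n K z where "\<And>r. Q r (n r) (K r) (z r)" by metis
  then have n: "\<And>r. r \<le> n r" and z0: "\<And>r k. k \<ge> K r \<Longrightarrow> z r k = 0"
    and z: "\<And>r. z r \<in> lp_space p" "\<And>r. lp_norm p (z r) \<le> 1"
    and big: "\<And>r. \<epsilon> < cmod (\<Sum>k<K r. (hat_matrix \<alpha> A (n r) k - \<beta> k) * z r k)"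
    unfolding Q_def by blast+
  define u where "u r = frac_diff (-\<alpha>) (z r)" for r
  have u: "u r \<in> lp_diff_space \<alpha> p" "lp_diff_norm \<alpha> p (u r) \<le> 1" for r
    using lp_diff_spaceI[OF \<alpha> z(1)] z(2) by (simp_all add: u_def lp_diff_norm_def frac_diff_inverse \<alpha>)
  then obtain y and s :: "nat \<Rightarrow> nat" where y: "y \<in> Y" and s: "strict_mono s"
    and lim: "(\<lambda>m. sup_norm (\<lambda>k. mat_apply A (u (s m)) k - y k)) \<longlonglongrightarrow> 0"
    using compact unfolding compact_operator_def by blast
  from y Y obtain \<gamma> where \<gamma>: "y \<longlonglongrightarrow> \<gamma>" by (auto simp: c_space_def convergent_def)
  have "\<forall>\<^sub>F m in sequentially. sup_norm (\<lambda>k. mat_apply A (u (s m)) k - y k) < \<epsilon> / 3"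
    using \<open>0 < \<epsilon>\<close> by (intro order_tendstoD(2)[OF lim]) simp
  moreover have "\<forall>\<^sub>F m in sequentially. dist (y (n (s m))) \<gamma> < \<epsilon> / 3"
  proof -
    have "filterlim (\<lambda>m. n (s m)) at_top sequentially"
    proof (rule filterlim_at_top_mono[OF filterlim_ident], rule always_eventually, rule allI)
      show "m \<le> n (s m)" for m using n[of "s m"] seq_suble[OF s, of m] by simp
    qed
    then show ?thesis
      using \<open>0 < \<epsilon>\<close> by (intro tendstoD[OF filterlim_compose[OF \<gamma>]]) auto
  qed
  ultimately obtain m where
    small: "sup_norm (\<lambda>k. mat_apply A (u (s m)) k - y k) < \<epsilon> / 3" "dist (y (n (s m))) \<gamma> < \<epsilon> / 3"
    using eventually_happens'[OF _ eventually_conj] by (metis (no_types, lifting) sequentially_bot)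
  define r where "r = s m"
  let ?v = "mat_apply A (u r)"
  \<comment> \<open>The limit of the image; the finite support of \<open>z r\<close> lets the row
    limit pass inside the sum.\<close>
  let ?l = "\<Sum>k<K r. \<beta> k * z r k"
  have v: "?v i = (\<Sum>k<K r. hat_matrix \<alpha> A i k * z r k)" for i
    unfolding u_def by (rule mat_apply_finite_support[OF \<alpha> p A z0])
  have v_lim: "?v \<longlonglongrightarrow> ?l"
    unfolding v by (intro tendsto_sum tendsto_mult \<beta> tendsto_const)
  have diff: "(\<lambda>i. ?v i - y i) \<longlonglongrightarrow> ?l - \<gamma>" by (intro tendsto_diff v_lim \<gamma>)
  have le: "cmod (?v i - y i) \<le> \<epsilon> / 3" for i
    using cmod_le_sup_norm[OF convergentI[OF diff], of i] small(1) by (simp add: r_def)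
  have "cmod (?l - \<gamma>) \<le> \<epsilon> / 3"
    by (rule LIMSEQ_le_const2[OF tendsto_norm[OF diff]]) (use le in blast)
  moreover have "\<epsilon> < cmod (?v (n r) - ?l)"
    using big[of r] by (simp add: v left_diff_distrib sum_subtractf)
  \<comment> \<open>Each of the three terms is at most \<epsilon>/3, against a left side above
    \<epsilon>.\<close>
  moreover have "cmod (?v (n r) - ?l) \<le> cmod (?v (n r) - y (n r)) + cmod (y (n r) - \<gamma>) + cmod (?l - \<gamma>)"
    using norm_triangle_ineq[of "?v (n r) - y (n r)" "y (n r) - \<gamma>"]
      norm_triangle_ineq4[of "?v (n r) - \<gamma>" "?l - \<gamma>"] by simp
  ultimately show False
    using le[of "n r"] small(2) by (simp add: r_def dist_norm)
qed

text \<open>The limit functional given by \<beta> acts as a coordinate at infinity, which the late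
  rows follow uniformly on the bounded sequence. Convergence there and at each finite coordinate is
  therefore convergence in sup norm. For c0 the condition \<beta> = 0 puts the limit back into the
  target.\<close>

lemma uniformly_small_imp_compact:
  assumes \<alpha>: "\<alpha> \<notin> \<int>" and p: "1 \<le> p"
    and Y: "Y = c_space \<or> Y = c0_space \<and> (\<forall>k. \<beta> k = 0)"
    and A: "A \<in> matrix_class (lp_diff_space \<alpha> p) Y"
    and small: "\<And>\<epsilon>. 0 < \<epsilon> \<Longrightarrow> \<exists>r. \<forall>n\<in>{r..}. dual_bounded p (\<lambda>k. hat_matrix \<alpha> A n k - \<beta> k) \<epsilon>"
  shows "compact_operator (lp_diff_space \<alpha> p) (lp_diff_norm \<alpha> p) Y sup_norm (mat_apply A)"
  unfolding compact_operator_def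
proof (intro conjI allI impI linear_between_mat_apply[OF A])
  have p0: "0 < p" using p by simp
  fix u :: "nat \<Rightarrow> cseq"
  assume "(\<forall>m. u m \<in> lp_diff_space \<alpha> p) \<and> (\<exists>B. \<forall>m. lp_diff_norm \<alpha> p (u m) \<le> B)"
  then obtain B where u: "\<And>m. u m \<in> lp_diff_space \<alpha> p" "\<And>m. lp_diff_norm \<alpha> p (u m) \<le> B" by blast
  define v where "v m = frac_diff \<alpha> (u m)" for m
  have v: "v m \<in> lp_space p" "lp_norm p (v m) \<le> B" for m
    using u[of m] by (simp_all add: v_def lp_diff_space_def lp_diff_norm_def)
  have B: "0 \<le> B" using lp_norm_nonneg v(2) order_trans by blast
  define L where "L m = (\<Sum>k. \<beta> k * v m k)" for m
  \<comment> \<open>A row minus its deviation from \<beta>, taken with tolerance 1, shows that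
    \<beta> is itself a bounded functional, so the series for \<open>L m\<close> converges.\<close>
  obtain C where C: "0 \<le> C" "dual_bounded p \<beta> C"
  proof -
    obtain r where "dual_bounded p (\<lambda>k. hat_matrix \<alpha> A r k - \<beta> k) 1"
      using small[of 1] by auto
    moreover obtain C where "0 \<le> C" "dual_bounded p (hat_matrix \<alpha> A r) C"
      using mat_apply_eq_hat_matrix(1)[OF \<alpha> p A] by blast
    ultimately have "dual_bounded p \<beta> (C + 1)"
      using dual_bounded_add[of p "hat_matrix \<alpha> A r" C "\<lambda>k. - (hat_matrix \<alpha> A r k - \<beta> k)" 1]
        dual_bounded_uminus by fastforce
    with \<open>0 \<le> C\<close> show ?thesis by (intro that[of "C + 1"]) auto
  qed
  have GL: "cmod (mat_apply A (u m) n - L m) \<le> \<epsilon> * B"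
    if "dual_bounded p (\<lambda>k. hat_matrix \<alpha> A n k - \<beta> k) \<epsilon>" "0 \<le> \<epsilon>" for m n \<epsilon>
  proof -
    have "(\<lambda>k. hat_matrix \<alpha> A n k * v m k) sums mat_apply A (u m) n"
      using mat_apply_eq_hat_matrix(2)[OF \<alpha> p A u(1)] by (simp add: v_def)
    moreover have "(\<lambda>k. \<beta> k * v m k) sums L m"
      unfolding L_def using dual_bounded_lp(1)[OF C(2,1) p0 v(1)] by (rule summable_sums)
    ultimately have "(\<lambda>k. (hat_matrix \<alpha> A n k - \<beta> k) * v m k) sums (mat_apply A (u m) n - L m)"
      unfolding left_diff_distrib by (rule sums_diff)
    then have "cmod (mat_apply A (u m) n - L m) \<le> \<epsilon> * lp_norm p (v m)"
      using dual_bounded_lp(2)[OF that p0 v(1), of m] by (simp add: sums_iff)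
    also have "\<dots> \<le> \<epsilon> * B" using v(2) that(2) by (rule mult_left_mono)
    finally show ?thesis .
  qed
  \<comment> \<open>\<open>case_nat\<close> inserts \<open>L m\<close> as coordinate 0, so a single
    diagonal extraction makes it converge together with all rows.\<close>
  have "bounded (range (\<lambda>m. case_nat (L m) (mat_apply A (u m)) n))" for n
  proof (cases n)
    case 0
    have "cmod (L m) \<le> C * B" for m
      unfolding L_def using dual_bounded_lp(2)[OF C(2,1) p0 v(1), of m] v(2)[of m] C(1)
      by (meson mult_left_mono order_trans)
    then show ?thesis by (auto simp: 0 bounded_iff)
  next
    case (Suc i)
    then show ?thesis using mat_apply_bounded[OF \<alpha> p A u] by simp
  qed
  then obtain s :: "nat \<Rightarrow> nat" and w where s: "strict_mono s"
    and w: "\<And>n. (\<lambda>m. case_nat (L (s m)) (mat_apply A (u (s m))) n) \<longlonglongrightarrow> w n"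
    by (rule pointwise_convergent_subsequence[of "\<lambda>m. case_nat (L m) (mat_apply A (u m))"]) blast
  define \<gamma> where "\<gamma> = w 0"
  define y where "y n = w (Suc n)" for n
  have L_lim: "(\<lambda>m. L (s m)) \<longlonglongrightarrow> \<gamma>" using w[of 0] by (simp add: \<gamma>_def)
  have G_lim: "(\<lambda>m. mat_apply A (u (s m)) n) \<longlonglongrightarrow> y n" for n
    using w[of "Suc n"] by (simp add: y_def)
  have unif: "\<exists>r. \<forall>n\<ge>r. (\<forall>m. cmod (mat_apply A (u m) n - L m) \<le> e / 4) \<and> cmod (y n - \<gamma>) \<le> e / 4"
    if "0 < e" for e
  proof -
    \<comment> \<open>The added 1 keeps \<epsilon> positive when \<open>B = 0\<close>.\<close>
    define \<epsilon> where "\<epsilon> = e / (4 * (B + 1))"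
    have \<epsilon>: "0 < \<epsilon>" "\<epsilon> * B \<le> e / 4" using that B by (simp_all add: \<epsilon>_def field_simps)
    obtain r where r: "\<forall>n\<in>{r..}. dual_bounded p (\<lambda>k. hat_matrix \<alpha> A n k - \<beta> k) \<epsilon>"
      using small[OF \<epsilon>(1)] by blast
    have le: "cmod (mat_apply A (u m) n - L m) \<le> e / 4" if "n \<ge> r" for m n
      using GL[of n \<epsilon> m] r that \<epsilon> by auto
    have "cmod (y n - \<gamma>) \<le> e / 4" if "n \<ge> r" for n
      by (rule LIMSEQ_le_const2[OF tendsto_norm[OF tendsto_diff[OF G_lim L_lim]]])
        (use le[OF that] in blast)
    with le show ?thesis by blast
  qed
  have y_lim: "y \<longlonglongrightarrow> \<gamma>"
  proof (rule LIMSEQ_I)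
    fix e :: real assume "0 < e"
    then obtain r where "\<forall>n\<ge>r. cmod (y n - \<gamma>) \<le> e / 4" using unif by blast
    with \<open>0 < e\<close> show "\<exists>r. \<forall>n\<ge>r. norm (y n - \<gamma>) < e" by (intro exI[of _ r]) fastforce
  qed
  have y: "y \<in> Y"
    using Y
  proof (elim disjE conjE)
    assume "Y = c_space"
    then show ?thesis using y_lim by (auto simp: c_space_def convergent_def)
  next
    assume "Y = c0_space" "\<forall>k. \<beta> k = 0"
    then have "\<gamma> = 0" using L_lim by (simp add: L_def LIMSEQ_const_iff)
    with y_lim \<open>Y = c0_space\<close> show ?thesis by (simp add: c0_space_def)
  qed
  have "(\<lambda>m. sup_norm (\<lambda>k. mat_apply A (u (s m)) k - y k)) \<longlonglongrightarrow> 0"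
  proof (rule LIMSEQ_I)
    fix e :: real assume "0 < e"
    then obtain r where r: "\<And>n m. n \<ge> r \<Longrightarrow> cmod (mat_apply A (u m) n - L m) \<le> e / 4"
        "\<And>n. n \<ge> r \<Longrightarrow> cmod (y n - \<gamma>) \<le> e / 4"
      using unif by blast
    have "\<forall>\<^sub>F m in sequentially. \<forall>n\<in>{..<r}. cmod (mat_apply A (u (s m)) n - y n) < e / 2"
      using \<open>0 < e\<close> tendstoD[OF G_lim, of "e / 2"]
      by (intro eventually_ball_finite) (auto simp: dist_norm)
    moreover have "\<forall>\<^sub>F m in sequentially. cmod (L (s m) - \<gamma>) < e / 4"
      using \<open>0 < e\<close> tendstoD[OF L_lim, of "e / 4"] by (simp add: dist_norm)
    ultimately have "\<forall>\<^sub>F m in sequentially. norm (sup_norm (\<lambda>k. mat_apply A (u (s m)) k - y k) - 0) < e"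
    proof eventually_elim
      case (elim m)
      \<comment> \<open>The margin below \<open>e\<close> matters: a supremum preserves only
        non-strict bounds. For n >= r the three errors are compared through \<open>L (s m)\<close>
        and \<gamma>.\<close>
      have le: "cmod (mat_apply A (u (s m)) n - y n) \<le> 3 * e / 4" for n
      proof (cases "n < r")
        case True
        then have "cmod (mat_apply A (u (s m)) n - y n) < e / 2" using elim(1) by simp
        with \<open>0 < e\<close> show ?thesis by linarith
      next
        case False
        then have "cmod (mat_apply A (u (s m)) n - L (s m)) \<le> e / 4" "cmod (y n - \<gamma>) \<le> e / 4"
          using r by auto
        then show ?thesis
          using elim(2) norm_triangle_ineq[of "mat_apply A (u (s m)) n - L (s m)" "L (s m) - \<gamma>"]
            norm_triangle_ineq4[of "mat_apply A (u (s m)) n - \<gamma>" "y n - \<gamma>"] by simp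
      qed
      have "sup_norm (\<lambda>k. mat_apply A (u (s m)) k - y k) \<le> 3 * e / 4"
        unfolding sup_norm_def by (rule cSUP_least) (use le in auto)
      moreover have "0 \<le> sup_norm (\<lambda>k. mat_apply A (u (s m)) k - y k)"
        unfolding sup_norm_def
        by (rule order_trans[OF norm_ge_zero cSUP_upper[of 0]], simp, rule bdd_aboveI2, rule le)
      ultimately show ?case using \<open>0 < e\<close> by simp
    qed
    then show "\<exists>r. \<forall>m\<ge>r. norm (sup_norm (\<lambda>k. mat_apply A (u (s m)) k - y k) - 0) < e"
      by (simp add: eventually_sequentially)
  qed
  with y s show "\<exists>y\<in>Y. \<exists>s :: nat \<Rightarrow> nat. strict_mono s \<and>
      (\<lambda>m. sup_norm (\<lambda>k. mat_apply A (u (s m)) k - y k)) \<longlonglongrightarrow> 0" by blast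
qed

section \<open>Compactness with values in l_1\<close>

lemma lp_space_1_iff: "x \<in> lp_space 1 \<longleftrightarrow> summable (\<lambda>k. cmod (x k))"
  by (simp add: lp_space_def)

lemma lp_norm_1: "x \<in> lp_space 1 \<Longrightarrow> lp_norm 1 x = (\<Sum>k. cmod (x k))"
  by (simp add: lp_norm_def lp_space_1_iff suminf_nonneg)

text \<open>The sets \<open>N r\<close> lie beyond \<open>r\<close>, so a summable limit
  \<open>y\<close> has little mass on them for large \<open>r\<close>. An image close to
  \<open>y\<close> in l_1 then has a small sum over \<open>N r\<close>, against its choice.\<close>

lemma compact_l1_imp_uniformly_small:
  assumes \<alpha>: "\<alpha> \<notin> \<int>" and p: "1 \<le> p"
    and A: "A \<in> matrix_class (lp_diff_space \<alpha> p) (lp_space 1)"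
    and compact: "compact_operator (lp_diff_space \<alpha> p) (lp_diff_norm \<alpha> p) (lp_space 1) (lp_norm 1) (mat_apply A)"
    and "0 < \<epsilon>"
  shows "\<exists>r. \<forall>N\<in>finite_sets_above r. dual_bounded p (\<lambda>k. \<Sum>n\<in>N. hat_matrix \<alpha> A n k) \<epsilon>"
proof (rule ccontr)
  assume neg: "\<not> ?thesis"
  have p0: "0 < p" using p by simp
  define Q where "Q r N K z \<longleftrightarrow> N \<in> finite_sets_above r \<and> (\<forall>k\<ge>K. z k = 0) \<and> z \<in> lp_space p \<and>
    lp_norm p z \<le> 1 \<and> \<epsilon> < cmod (\<Sum>k<K. (\<Sum>n\<in>N. hat_matrix \<alpha> A n k) * z k)" for r N and K :: nat and z
  have "\<exists>N K z. Q r N K z" for r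
  proof -
    from neg obtain N where N: "N \<in> finite_sets_above r" "\<not> dual_bounded p (\<lambda>k. \<Sum>n\<in>N. hat_matrix \<alpha> A n k) \<epsilon>"
      by auto
    show ?thesis
      by (rule not_dual_boundedE[OF N(2) p0]) (use N(1) in \<open>auto simp: Q_def\<close>)
  qed
  then obtain N K z where "\<And>r. Q r (N r) (K r) (z r)" by metis
  then have N: "\<And>r. N r \<in> finite_sets_above r" and z0: "\<And>r k. k \<ge> K r \<Longrightarrow> z r k = 0"
    and z: "\<And>r. z r \<in> lp_space p" "\<And>r. lp_norm p (z r) \<le> 1"
    and big: "\<And>r. \<epsilon> < cmod (\<Sum>k<K r. (\<Sum>n\<in>N r. hat_matrix \<alpha> A n k) * z r k)"
    unfolding Q_def by blast+
  define u where "u r = frac_diff (-\<alpha>) (z r)" for r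
  have u: "u r \<in> lp_diff_space \<alpha> p" "lp_diff_norm \<alpha> p (u r) \<le> 1" for r
    using lp_diff_spaceI[OF \<alpha> z(1)] z(2) by (simp_all add: u_def lp_diff_norm_def frac_diff_inverse \<alpha>)
  then obtain y and s :: "nat \<Rightarrow> nat" where y: "y \<in> lp_space 1" and s: "strict_mono s"
    and lim: "(\<lambda>m. lp_norm 1 (\<lambda>k. mat_apply A (u (s m)) k - y k)) \<longlonglongrightarrow> 0"
    using compact unfolding compact_operator_def by blast
  have y_sm: "summable (\<lambda>k. cmod (y k))" using y by (simp add: lp_space_1_iff)
  have "\<forall>\<^sub>F m in sequentially. lp_norm 1 (\<lambda>k. mat_apply A (u (s m)) k - y k) < \<epsilon> / 2"
    using \<open>0 < \<epsilon>\<close> by (intro order_tendstoD(2)[OF lim]) simp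
  moreover have "\<forall>\<^sub>F m in sequentially. (\<Sum>k. cmod (y (k + m))) < \<epsilon> / 2"
    using \<open>0 < \<epsilon>\<close> by (intro order_tendstoD(2)[OF suminf_exist_split2[OF y_sm]]) simp
  ultimately obtain m where
    small: "lp_norm 1 (\<lambda>k. mat_apply A (u (s m)) k - y k) < \<epsilon> / 2" "(\<Sum>k. cmod (y (k + m))) < \<epsilon> / 2"
    using eventually_happens'[OF _ eventually_conj] by (metis (no_types, lifting) sequentially_bot)
  define r where "r = s m"
  let ?v = "mat_apply A (u r)"
  \<comment> \<open>Elements of \<open>N r\<close> exceed r = s m >= m, so the tail of
    \<open>y\<close> from \<open>m\<close> on covers them.\<close>
  have Nr: "finite (N r)" "N r \<subseteq> {m..}"
    using N[of r] seq_suble[OF s, of m] by (auto simp: finite_sets_above_def r_def)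
  have v: "?v i = (\<Sum>k<K r. hat_matrix \<alpha> A i k * z r k)" for i
    unfolding u_def by (rule mat_apply_finite_support[OF \<alpha> p A z0])
  have "?v \<in> lp_space 1" using A u(1) by (simp add: matrix_class_def)
  then have d: "(\<lambda>k. ?v k - y k) \<in> lp_space 1" using y by (intro lp_space_diff) auto
  have "\<epsilon> < cmod (\<Sum>n\<in>N r. ?v n)"
    using big[of r] unfolding v sum_distrib_right by (subst sum.swap)
  also have "\<dots> \<le> (\<Sum>n\<in>N r. cmod (?v n - y n) + cmod (y n))"
    by (intro sum_norm_le) (metis diff_add_cancel norm_triangle_ineq)
  also have "\<dots> = (\<Sum>n\<in>N r. cmod (?v n - y n)) + (\<Sum>n\<in>N r. cmod (y n))" by (rule sum.distrib)
  also have "(\<Sum>n\<in>N r. cmod (?v n - y n)) \<le> lp_norm 1 (\<lambda>k. ?v k - y k)"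
    using d Nr(1) by (simp add: lp_norm_1) (intro sum_le_suminf, auto simp: lp_space_1_iff)
  also have "(\<Sum>n\<in>N r. cmod (y n)) \<le> (\<Sum>k. cmod (y (k + m)))"
  proof -
    have "(\<Sum>n\<in>N r. cmod (y n)) + (\<Sum>n<m. cmod (y n)) = (\<Sum>n\<in>N r \<union> {..<m}. cmod (y n))"
      using Nr by (intro sum.union_disjoint[symmetric]) auto
    also have "\<dots> \<le> (\<Sum>n. cmod (y n))" using Nr(1) y_sm by (intro sum_le_suminf) auto
    finally show ?thesis using suminf_split_initial_segment[OF y_sm, of m] by simp
  qed
  finally show False using small by (simp add: r_def)
qed

text \<open>Small subset sums of rows give small subset sums of the images, uniformly in the bounded
  sequence, and hence uniformly small l_1 tails. With such tails coordinatewise convergence is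
  convergence in norm.\<close>

lemma uniformly_small_imp_compact_l1:
  assumes \<alpha>: "\<alpha> \<notin> \<int>" and p: "1 \<le> p"
    and A: "A \<in> matrix_class (lp_diff_space \<alpha> p) (lp_space 1)"
    and small: "\<And>\<epsilon>. 0 < \<epsilon> \<Longrightarrow>
      \<exists>r. \<forall>N\<in>finite_sets_above r. dual_bounded p (\<lambda>k. \<Sum>n\<in>N. hat_matrix \<alpha> A n k) \<epsilon>"
  shows "compact_operator (lp_diff_space \<alpha> p) (lp_diff_norm \<alpha> p) (lp_space 1) (lp_norm 1) (mat_apply A)"
  unfolding compact_operator_def
proof (intro conjI allI impI linear_between_mat_apply[OF A])
  have p0: "0 < p" using p by simp
  fix u :: "nat \<Rightarrow> cseq"
  assume "(\<forall>m. u m \<in> lp_diff_space \<alpha> p) \<and> (\<exists>B. \<forall>m. lp_diff_norm \<alpha> p (u m) \<le> B)"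
  then obtain B where u: "\<And>m. u m \<in> lp_diff_space \<alpha> p" "\<And>m. lp_diff_norm \<alpha> p (u m) \<le> B" by blast
  define v where "v m = frac_diff \<alpha> (u m)" for m
  have v: "v m \<in> lp_space p" "lp_norm p (v m) \<le> B" for m
    using u[of m] by (simp_all add: v_def lp_diff_space_def lp_diff_norm_def)
  have B: "0 \<le> B" using lp_norm_nonneg v(2) order_trans by blast
  let ?G = "\<lambda>m. mat_apply A (u m)"
  have sum_G: "cmod (\<Sum>n\<in>N. ?G m n) \<le> \<epsilon> * B"
    if "dual_bounded p (\<lambda>k. \<Sum>n\<in>N. hat_matrix \<alpha> A n k) \<epsilon>" "0 \<le> \<epsilon>" for m N \<epsilon>
  proof -
    have "(\<lambda>k. hat_matrix \<alpha> A n k * v m k) sums ?G m n" for n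
      using mat_apply_eq_hat_matrix(2)[OF \<alpha> p A u(1)] by (simp add: v_def)
    then have "(\<lambda>k. (\<Sum>n\<in>N. hat_matrix \<alpha> A n k) * v m k) sums (\<Sum>n\<in>N. ?G m n)"
      unfolding sum_distrib_right by (intro sums_sum) auto
    then have "cmod (\<Sum>n\<in>N. ?G m n) \<le> \<epsilon> * lp_norm p (v m)"
      using dual_bounded_lp(2)[OF that p0 v(1), of m] by (simp add: sums_iff)
    also have "\<dots> \<le> \<epsilon> * B" using v(2) that(2) by (rule mult_left_mono)
    finally show ?thesis .
  qed
  obtain s :: "nat \<Rightarrow> nat" and y where s: "strict_mono s" and G_lim: "\<And>n. (\<lambda>m. ?G (s m) n) \<longlonglongrightarrow> y n"
    using mat_apply_bounded[OF \<alpha> p A u] by (rule pointwise_convergent_subsequence[of ?G]) blast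
  have unif: "\<exists>r. \<forall>F. finite F \<and> F \<subseteq> {r<..} \<longrightarrow>
      (\<forall>m. (\<Sum>n\<in>F. cmod (?G m n)) \<le> e) \<and> (\<Sum>n\<in>F. cmod (y n)) \<le> e" if "0 < e" for e
  proof -
    \<comment> \<open>Here the 4 offsets the loss in \<open>sum_cmod_le_subset_sums\<close>.\<close>
    define \<epsilon> where "\<epsilon> = e / (4 * (B + 1))"
    have \<epsilon>: "0 < \<epsilon>" "4 * (\<epsilon> * B) \<le> e" using that B by (simp_all add: \<epsilon>_def field_simps)
    obtain r where r: "\<forall>N\<in>finite_sets_above r. dual_bounded p (\<lambda>k. \<Sum>n\<in>N. hat_matrix \<alpha> A n k) \<epsilon>"
      using small[OF \<epsilon>(1)] by blast
    have le: "(\<Sum>n\<in>F. cmod (?G m n)) \<le> e" if F: "finite F" "F \<subseteq> {r<..}" for F m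
    proof -
      have "(\<Sum>n\<in>F. cmod (?G m n)) \<le> 4 * (\<epsilon> * B)"
      proof (rule sum_cmod_le_subset_sums[OF F(1)])
        fix N assume "N \<subseteq> F" "N \<noteq> {}"
        then have "N \<in> finite_sets_above r"
          using F by (auto simp: finite_sets_above_def intro: finite_subset)
        then show "cmod (\<Sum>n\<in>N. ?G m n) \<le> \<epsilon> * B" using r \<epsilon>(1) by (intro sum_G) auto
      qed (use \<epsilon>(1) B in simp)
      with \<epsilon>(2) show ?thesis by linarith
    qed
    \<comment> \<open>On finite sets the bound passes to the coordinatewise limit before
      \<open>y\<close> is known to be summable; its summability is deduced from this bound.\<close>
    have "(\<Sum>n\<in>F. cmod (y n)) \<le> e" if "finite F" "F \<subseteq> {r<..}" for F
      by (rule LIMSEQ_le_const2[OF tendsto_sum[OF tendsto_norm[OF G_lim]]]) (use le[OF that] in blast)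
    with le show ?thesis by blast
  qed
  have y: "y \<in> lp_space 1"
  proof -
    obtain r where r: "\<And>F. finite F \<Longrightarrow> F \<subseteq> {r<..} \<Longrightarrow> (\<Sum>n\<in>F. cmod (y n)) \<le> 1"
      using unif[of 1] by auto
    have "(\<Sum>n<K. cmod (y n)) \<le> (\<Sum>n\<le>r. cmod (y n)) + 1" for K
    proof -
      have "(\<Sum>n<K. cmod (y n)) \<le> (\<Sum>n\<in>{..r} \<union> {r<..<K}. cmod (y n))"
        by (intro sum_mono2) auto
      also have "\<dots> = (\<Sum>n\<le>r. cmod (y n)) + (\<Sum>n\<in>{r<..<K}. cmod (y n))"
        by (intro sum.union_disjoint) auto
      also have "(\<Sum>n\<in>{r<..<K}. cmod (y n)) \<le> 1" by (intro r) auto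
      finally show ?thesis by simp
    qed
    then show ?thesis unfolding lp_space_1_iff by (intro summableI_nonneg_bounded) auto
  qed
  have "(\<lambda>m. lp_norm 1 (\<lambda>k. ?G (s m) k - y k)) \<longlonglongrightarrow> 0"
  proof (rule LIMSEQ_I)
    fix e :: real assume e: "0 < e"
    then obtain r where r: "\<And>F m. finite F \<Longrightarrow> F \<subseteq> {r<..} \<Longrightarrow> (\<Sum>n\<in>F. cmod (?G m n)) \<le> e / 4"
        "\<And>F. finite F \<Longrightarrow> F \<subseteq> {r<..} \<Longrightarrow> (\<Sum>n\<in>F. cmod (y n)) \<le> e / 4"
      using unif[of "e / 4"] by auto
    have "(\<lambda>m. \<Sum>n\<le>r. cmod (?G (s m) n - y n)) \<longlonglongrightarrow> (\<Sum>n\<le>r. cmod (y n - y n))"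
      by (intro tendsto_sum tendsto_norm tendsto_diff G_lim tendsto_const)
    then have "\<forall>\<^sub>F m in sequentially. (\<Sum>n\<le>r. cmod (?G (s m) n - y n)) < e / 2"
      using e by (intro order_tendstoD(2)) auto
    then have "\<forall>\<^sub>F m in sequentially. norm (lp_norm 1 (\<lambda>k. ?G (s m) k - y k) - 0) < e"
    proof eventually_elim
      case (elim m)
      have d: "(\<lambda>k. ?G (s m) k - y k) \<in> lp_space 1"
        using A u(1) y by (intro lp_space_diff) (auto simp: matrix_class_def)
      have "(\<Sum>n<K. cmod (?G (s m) n - y n)) \<le> (\<Sum>n\<le>r. cmod (?G (s m) n - y n)) + e / 2" for K
      proof -
        have "(\<Sum>n<K. cmod (?G (s m) n - y n)) \<le> (\<Sum>n\<in>{..r} \<union> {r<..<K}. cmod (?G (s m) n - y n))"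
          by (intro sum_mono2) auto
        also have "\<dots> = (\<Sum>n\<le>r. cmod (?G (s m) n - y n)) + (\<Sum>n\<in>{r<..<K}. cmod (?G (s m) n - y n))"
          by (intro sum.union_disjoint) auto
        also have "(\<Sum>n\<in>{r<..<K}. cmod (?G (s m) n - y n)) \<le> (\<Sum>n\<in>{r<..<K}. cmod (?G (s m) n) + cmod (y n))"
          by (intro sum_mono norm_triangle_ineq4)
        also have "\<dots> \<le> e / 2"
          using r(1)[of "{r<..<K}" "s m"] r(2)[of "{r<..<K}"] by (simp add: sum.distrib subset_iff)
        finally show ?thesis by simp
      qed
      then have "lp_norm 1 (\<lambda>k. ?G (s m) k - y k) \<le> (\<Sum>n\<le>r. cmod (?G (s m) n - y n)) + e / 2"
        unfolding lp_norm_1[OF d] using d by (intro suminf_le_const) (auto simp: lp_space_1_iff)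
      with elim show ?case using lp_norm_nonneg[of 1 "\<lambda>k. ?G (s m) k - y k"] by simp
    qed
    then show "\<exists>r. \<forall>m\<ge>r. norm (lp_norm 1 (\<lambda>k. ?G (s m) k - y k) - 0) < e"
      by (simp add: eventually_sequentially)
  qed
  with y s show "\<exists>y\<in>lp_space 1. \<exists>s :: nat \<Rightarrow> nat. strict_mono s \<and>
      (\<lambda>m. lp_norm 1 (\<lambda>k. ?G (s m) k - y k)) \<longlonglongrightarrow> 0" by blast
qed

text \<open>Only the unit ball of the dual norm matters, so \<open>l\<^sub>q\<close> (for \<open>p > 1\<close>) and \<open>l\<^sub>\<infinity>\<close>
  (for \<open>p = 1\<close>) are treated through one abstract norm \<open>E\<close>.\<close>

lemma compact_operator_c0_iff:
  assumes \<alpha>: "\<alpha> \<notin> \<int>" and p: "1 \<le> p" and A: "A \<in> matrix_class (lp_diff_space \<alpha> p) c0_space"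
    and E: "\<And>b M. 0 \<le> M \<Longrightarrow> E b \<le> ennreal M \<longleftrightarrow> dual_bounded p b M"
  shows "compact_operator (lp_diff_space \<alpha> p) (lp_diff_norm \<alpha> p) c0_space sup_norm (mat_apply A) \<longleftrightarrow>
    (\<lambda>r::nat. SUP n\<in>{r..}. E (\<lambda>k. hat_matrix \<alpha> A n k)) \<longlonglongrightarrow> 0"
proof -
  have c0: "c0_space \<subseteq> c_space" by (auto simp: c0_space_def c_space_def convergent_def)
  have \<beta>: "(\<lambda>n. hat_matrix \<alpha> A n k) \<longlonglongrightarrow> 0" for k
    using hat_matrix_column[OF \<alpha> p A, of k] by (simp add: c0_space_def)
  \<comment> \<open>The explicit \<open>- 0\<close> on the right makes the criterion an instance of
    the two lemmas above with \<beta> = 0.\<close>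
  have "(\<lambda>r::nat. SUP n\<in>{r..}. E (\<lambda>k. hat_matrix \<alpha> A n k)) \<longlonglongrightarrow> 0 \<longleftrightarrow>
      (\<forall>\<epsilon>>0. \<exists>r. \<forall>n\<in>{r..}. dual_bounded p (\<lambda>k. hat_matrix \<alpha> A n k - 0) \<epsilon>)"
    by (subst ennreal_SUP_tendsto_0_iff) (auto simp: antimono_def E)
  then show ?thesis
    using compact_imp_uniformly_small[OF \<alpha> p c0 A \<beta>]
      uniformly_small_imp_compact[OF \<alpha> p _ A, of "\<lambda>_. 0"] by blast
qed

lemma compact_operator_c_iff:
  assumes \<alpha>: "\<alpha> \<notin> \<int>" and p: "1 \<le> p" and A: "A \<in> matrix_class (lp_diff_space \<alpha> p) c_space"
    and E: "\<And>b M. 0 \<le> M \<Longrightarrow> E b \<le> ennreal M \<longleftrightarrow> dual_bounded p b M"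
  shows "compact_operator (lp_diff_space \<alpha> p) (lp_diff_norm \<alpha> p) c_space sup_norm (mat_apply A) \<longleftrightarrow>
    (\<lambda>r::nat. SUP n\<in>{r..}. E (\<lambda>k. hat_matrix \<alpha> A n k - hat_limit \<alpha> A k)) \<longlonglongrightarrow> 0"
proof -
  have \<beta>: "(\<lambda>n. hat_matrix \<alpha> A n k) \<longlonglongrightarrow> hat_limit \<alpha> A k" for k
    using hat_matrix_column[OF \<alpha> p A, of k] by (simp add: c_space_def hat_limit_def convergent_LIMSEQ_iff)
  have "(\<lambda>r::nat. SUP n\<in>{r..}. E (\<lambda>k. hat_matrix \<alpha> A n k - hat_limit \<alpha> A k)) \<longlonglongrightarrow> 0 \<longleftrightarrow>
      (\<forall>\<epsilon>>0. \<exists>r. \<forall>n\<in>{r..}. dual_bounded p (\<lambda>k. hat_matrix \<alpha> A n k - hat_limit \<alpha> A k) \<epsilon>)"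
    by (subst ennreal_SUP_tendsto_0_iff) (auto simp: antimono_def E)
  then show ?thesis
    using compact_imp_uniformly_small[OF \<alpha> p subset_refl A \<beta>]
      uniformly_small_imp_compact[OF \<alpha> p _ A, of "hat_limit \<alpha> A"] by blast
qed

lemma compact_operator_l1_iff:
  assumes \<alpha>: "\<alpha> \<notin> \<int>" and p: "1 \<le> p" and A: "A \<in> matrix_class (lp_diff_space \<alpha> p) (lp_space 1)"
    and E: "\<And>b M. 0 \<le> M \<Longrightarrow> E b \<le> ennreal M \<longleftrightarrow> dual_bounded p b M"
  shows "compact_operator (lp_diff_space \<alpha> p) (lp_diff_norm \<alpha> p) (lp_space 1) (lp_norm 1) (mat_apply A) \<longleftrightarrow>
    (\<lambda>r::nat. SUP N\<in>finite_sets_above r. E (\<lambda>k. \<Sum>n\<in>N. hat_matrix \<alpha> A n k)) \<longlonglongrightarrow> 0"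
proof -
  have "antimono finite_sets_above" by (fastforce simp: antimono_def finite_sets_above_def)
  then have "(\<lambda>r::nat. SUP N\<in>finite_sets_above r. E (\<lambda>k. \<Sum>n\<in>N. hat_matrix \<alpha> A n k)) \<longlonglongrightarrow> 0 \<longleftrightarrow>
      (\<forall>\<epsilon>>0. \<exists>r. \<forall>N\<in>finite_sets_above r. dual_bounded p (\<lambda>k. \<Sum>n\<in>N. hat_matrix \<alpha> A n k) \<epsilon>)"
    by (subst ennreal_SUP_tendsto_0_iff) (auto simp: E)
  then show ?thesis
    using compact_l1_imp_uniformly_small[OF \<alpha> p A] uniformly_small_imp_compact_l1[OF \<alpha> p A] by blast
qed

theorem mainTheorem5:
  fixes \<alpha> p q :: real and A :: cmatrix
  assumes "\<alpha> \<notin> \<int>" and "1 < p" and "q = p / (p - 1)"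
  shows
    "(A \<in> matrix_class (lp_diff_space \<alpha> p) c0_space \<longrightarrow>
       (compact_operator (lp_diff_space \<alpha> p) (lp_diff_norm \<alpha> p) c0_space sup_norm (mat_apply A) \<longleftrightarrow>
        (\<lambda>r::nat. SUP n\<in>{r..}. elp_norm q (\<lambda>k. hat_matrix \<alpha> A n k)) \<longlonglongrightarrow> 0)) \<and>
     (A \<in> matrix_class (lp_diff_space \<alpha> p) c_space \<longrightarrow>
       (compact_operator (lp_diff_space \<alpha> p) (lp_diff_norm \<alpha> p) c_space sup_norm (mat_apply A) \<longleftrightarrow>
        (\<lambda>r::nat. SUP n\<in>{r..}. elp_norm q (\<lambda>k. hat_matrix \<alpha> A n k - hat_limit \<alpha> A k))
          \<longlonglongrightarrow> 0)) \<and>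
     (A \<in> matrix_class (lp_diff_space \<alpha> p) (lp_space 1) \<longrightarrow>
       (compact_operator (lp_diff_space \<alpha> p) (lp_diff_norm \<alpha> p) (lp_space 1) (lp_norm 1) (mat_apply A) \<longleftrightarrow>
        (\<lambda>r::nat. SUP N\<in>finite_sets_above r. elp_norm q (\<lambda>k. \<Sum>n\<in>N. hat_matrix \<alpha> A n k))
          \<longlonglongrightarrow> 0)) \<and>
     (A \<in> matrix_class (lp_diff_space \<alpha> 1) c0_space \<longrightarrow>
       (compact_operator (lp_diff_space \<alpha> 1) (lp_diff_norm \<alpha> 1) c0_space sup_norm (mat_apply A) \<longleftrightarrow>
        (\<lambda>r::nat. SUP n\<in>{r..}. esup_norm (\<lambda>k. hat_matrix \<alpha> A n k)) \<longlonglongrightarrow> 0)) \<and>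
     (A \<in> matrix_class (lp_diff_space \<alpha> 1) c_space \<longrightarrow>
       (compact_operator (lp_diff_space \<alpha> 1) (lp_diff_norm \<alpha> 1) c_space sup_norm (mat_apply A) \<longleftrightarrow>
        (\<lambda>r::nat. SUP n\<in>{r..}. esup_norm (\<lambda>k. hat_matrix \<alpha> A n k - hat_limit \<alpha> A k))
          \<longlonglongrightarrow> 0))"
proof -
  have p: "1 \<le> p" using assms(2) by simp
  note dual = elp_norm_le_iff_dual_bounded[OF assms(2,3)] esup_norm_le_iff_dual_bounded
  show ?thesis
    using compact_operator_c0_iff[OF assms(1) p _ dual(1)] compact_operator_c_iff[OF assms(1) p _ dual(1)]
      compact_operator_l1_iff[OF assms(1) p _ dual(1)] compact_operator_c0_iff[OF assms(1) order_refl _ dual(2)]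
      compact_operator_c_iff[OF assms(1) order_refl _ dual(2)]
    by (intro conjI impI) simp_all
qed

end
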